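(* Let $V$ be a (finite dimensional) Yetter–Drinfel'd module of diagonal type over $kG$ and let $W\subset\mathcal{B}(V)^+$ be an $n$-dimensional Yetter–Drinfel'd submodule, where $n\in\mathbb{N}_0$. Choose a canonical basis $\{w_i\mid 1\le i\le n\}$ of $W$ and let $A$ denote the subalgebra of $\mathcal{B}(V)$ generated by $W$. If there exist $\lambda_i\in k\setminus\{0\}$, $1\le i\le n$, such that the restrictions of $\langle\iota(w_i),\cdot\rangle$ to $A$ are skew-primitive and $\langle\iota(w_i),w_j\rangle=\delta_{ij}\lambda_i$ for all $1\le i,j\le n$, then $\mathcal{B}(W)$ is a quotient algebra of $A$. In particular, $\dim_k\mathcal{B}(W)=\infty$ implies $\dim_k\mathcal{B}(V)=\infty$.
   Context: $k$ is a field of characteristic zero and $G$ an abelian group. A finite dimensional Yetter–Drinfel'd module $V$ over $kG$ is of diagonal type if it has a canonical basis: a basis $\{x_1,\dots,x_d\}$ with $g_i\in G$, $q_{ij}\in k\setminus\{0\}$ such that $\delta(x_i)=g_i\otimes x_i$ and $g_i.x_j=q_{ij}x_j$ ($G$ acting diagonally); the braiding is $\sigma(x_i\otimes x_j)=q_{ij}x_j\otimes x_i$. A canonical basis of such a $V$ is fixed. $\mathcal{B}(V)$ is the Nichols algebra of $V$ (quotient of $T(V)$ by its largest graded Hopf ideal generated in degrees $\ge2$), with $G$-action and $kG$-coaction extended from $V$; $\mathcal{B}(V)^+$ is its unique maximal ideal (elements without constant term). Let $V^*$ be the left dual Yetter–Drinfel'd module with dual basis $\{y_i\}$: $\delta(y_i)=g_i^{-1}\otimes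 y_i$, $g_i.y_j=q_{ij}^{-1}y_j$. The linear map $x_i\mapsto y_i$ extends to an algebra isomorphism $\iota:\mathcal{B}(V)\to\mathcal{B}(V^* )$. The Hopf algebra $\mathcal{B}(V^* )\#kG$ is the vector space $\mathcal{B}(V^* )\otimes kG$ with product $(f'\otimes g')(f''\otimes g'')=f'(g'.f'')\otimes g'g''$ and coproduct $\Delta(f)=f\otimes1+\delta(f)$ for $f\in V^*$, $\Delta(g)=g\otimes g$ for $g\in G$. It acts on $\mathcal{B}(V)$ by the unique action $\langle\cdot,\cdot\rangle$ with $\langle f,v\rangle=f(v)$ for $f\in V^*,v\in V$; $\langle g,\rho\rangle=g.\rho$ for $g\in G$; $\langle f_1f_2,\rho\rangle=\langle f_1,\langle f_2,\rho\rangle\rangle$; and $\langle f,\rho\rho'\rangle=\langle f_{(1)},\rho\rangle\langle f_{(2)},\rho'\rangle$. For $w_i$ with $\delta(w_i)=h_i\otimes w_i$, the restriction of $\langle\iota(w_i),\cdot\rangle$ to $A$ being skew-primitive means that $\Delta(\iota(w_i))$ and $\iota(w_i)\otimes1+h_i^{-1}\otimes\iota(w_i)$ act in the same way on $A\otimes A$; in particular $\langle\iota(w_i),ab\rangle=\langle\iota(w_i),a\rangle b+(h_i^{-1}.a)\langle\iota(w_i),b\rangle$ for all $a,b\in A$. *)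

theory Defs
  imports "HOL-Algebra.QuotRing" "HOL-Algebra.Module" "HOL-Library.Poly_Mapping"
begin

abbreviation "lookup \<equiv> Poly_Mapping.lookup"
abbreviation "keys \<equiv> Poly_Mapping.keys"
abbreviation "single \<equiv> Poly_Mapping.single"

section \<open>Algebras over a field\<close>

text \<open>
  A (not necessarily commutative) algebra over the field \<open>'k\<close> is presented by a \<open>module\<close> record,
  whose scalar multiplication takes its scalars from the type \<open>'k\<close>.
\<close>

definition is_subspace :: "('k, 'a) module \<Rightarrow> 'a set \<Rightarrow> bool" where
  "is_subspace M S \<longleftrightarrow> S \<subseteq> carrier M \<and> \<zero>\<^bsub>M\<^esub> \<in> S \<and>
     (\<forall>x\<in>S. \<forall>y\<in>S. x \<oplus>\<^bsub>M\<^esub> y \<in> S) \<and> (\<forall>c. \<forall>x\<in>S. c \<odot>\<^bsub>M\<^esub> x \<in> S)"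

definition span_in :: "('k, 'a) module \<Rightarrow> 'a set \<Rightarrow> 'a set" where
  "span_in M X = \<Inter>{S. is_subspace M S \<and> X \<subseteq> S}"

definition finite_dim :: "('k, 'a) module \<Rightarrow> bool" where
  "finite_dim M \<longleftrightarrow> (\<exists>X. finite X \<and> X \<subseteq> carrier M \<and> span_in M X = carrier M)"

definition is_basis :: "('k::field, 'a) module \<Rightarrow> nat \<Rightarrow> (nat \<Rightarrow> 'a) \<Rightarrow> 'a set \<Rightarrow> bool" where
  "is_basis M n b W \<longleftrightarrow> (\<forall>i<n. b i \<in> carrier M) \<and> span_in M (b ` {..<n}) = W \<and>
     (\<forall>c. (\<Oplus>\<^bsub>M\<^esub>i\<in>{..<n}. c i \<odot>\<^bsub>M\<^esub> b i) = \<zero>\<^bsub>M\<^esub> \<longrightarrow> (\<forall>i<n. c i = 0))"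

definition is_subalgebra :: "('k, 'a) module \<Rightarrow> 'a set \<Rightarrow> bool" where
  "is_subalgebra M S \<longleftrightarrow> is_subspace M S \<and> \<one>\<^bsub>M\<^esub> \<in> S \<and> (\<forall>x\<in>S. \<forall>y\<in>S. x \<otimes>\<^bsub>M\<^esub> y \<in> S)"

definition generated_subalgebra :: "('k, 'a) module \<Rightarrow> 'a set \<Rightarrow> 'a set" where
  "generated_subalgebra M X = \<Inter>{S. is_subalgebra M S \<and> X \<subseteq> S}"

definition alg_hom :: "('k, 'a) module \<Rightarrow> ('k, 'b) module \<Rightarrow> ('a \<Rightarrow> 'b) set" where
  "alg_hom M N = {\<phi> \<in> ring_hom M N. \<forall>c. \<forall>x\<in>carrier M. \<phi> (c \<odot>\<^bsub>M\<^esub> x) = c \<odot>\<^bsub>N\<^esub> \<phi> x}"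

text \<open>The map on cosets of \<open>I\<close> induced by a map \<open>f\<close> that preserves \<open>I\<close>.\<close>

definition induced_map :: "('k, 'a) module \<Rightarrow> 'a set \<Rightarrow> ('a \<Rightarrow> 'a) \<Rightarrow> 'a set \<Rightarrow> 'a set" where
  "induced_map M I f C = (\<Union>x\<in>C. I +>\<^bsub>M\<^esub> f x)"

definition quotient_algebra :: "('k, 'a) module \<Rightarrow> 'a set \<Rightarrow> ('k, 'a set) module" where
  "quotient_algebra M I =
     \<lparr>carrier = carrier (M Quot I), mult = mult (M Quot I), one = one (M Quot I),
      zero = zero (M Quot I), add = add (M Quot I),
      smult = (\<lambda>c. induced_map M I (\<lambda>x. c \<odot>\<^bsub>M\<^esub> x))\<rparr>"

section \<open>Tensor products\<close>

definition scale :: "'k::field \<Rightarrow> ('x \<Rightarrow>\<^sub>0 'k) \<Rightarrow> ('x \<Rightarrow>\<^sub>0 'k)" where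
  "scale c = Poly_Mapping.map ((*) c)"

definition lin_ext :: "('x \<Rightarrow> ('y \<Rightarrow>\<^sub>0 'k)) \<Rightarrow> ('x \<Rightarrow>\<^sub>0 'k) \<Rightarrow> ('y \<Rightarrow>\<^sub>0 'k::field)" where
  "lin_ext f p = (\<Sum>x\<in>keys p. scale (lookup p x) (f x))"

text \<open>
  The tensor product of two algebras is the space of formal linear combinations of pairs \<open>(a, b)\<close>
  modulo the span of the bilinearity relations; the class of \<open>(a, b)\<close> is \<open>a \<otimes> b\<close>.
\<close>

definition formal_pairs ::
  "('k::field, 'a) module \<Rightarrow> ('k, 'b) module \<Rightarrow> ('k, ('a \<times> 'b) \<Rightarrow>\<^sub>0 'k) module" where
  "formal_pairs M N =
     \<lparr>carrier = {z. keys z \<subseteq> carrier M \<times> carrier N},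
      mult = (\<lambda>z z'. \<Sum>x\<in>keys z. \<Sum>y\<in>keys z'.
        single (fst x \<otimes>\<^bsub>M\<^esub> fst y, snd x \<otimes>\<^bsub>N\<^esub> snd y) (lookup z x * lookup z' y)),
      one = single (\<one>\<^bsub>M\<^esub>, \<one>\<^bsub>N\<^esub>) 1, zero = 0, add = (+), smult = scale\<rparr>"

definition bilinear_relators ::
  "('k::field, 'a) module \<Rightarrow> ('k, 'b) module \<Rightarrow> (('a \<times> 'b) \<Rightarrow>\<^sub>0 'k) set" where
  "bilinear_relators M N =
     {single (a \<oplus>\<^bsub>M\<^esub> a', b) 1 - single (a, b) 1 - single (a', b) 1
        | a a' b. a \<in> carrier M \<and> a' \<in> carrier M \<and> b \<in> carrier N} \<union>
     {single (a, b \<oplus>\<^bsub>N\<^esub> b') 1 - single (a, b) 1 - single (a, b') 1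
        | a b b'. a \<in> carrier M \<and> b \<in> carrier N \<and> b' \<in> carrier N} \<union>
     {single (c \<odot>\<^bsub>M\<^esub> a, b) 1 - single (a, b) c
        | c a b. a \<in> carrier M \<and> b \<in> carrier N} \<union>
     {single (a, c \<odot>\<^bsub>N\<^esub> b) 1 - single (a, b) c
        | c a b. a \<in> carrier M \<and> b \<in> carrier N}"

definition tensor_class ::
  "('k::field, 'a) module \<Rightarrow> ('k, 'b) module \<Rightarrow> (('a \<times> 'b) \<Rightarrow>\<^sub>0 'k) \<Rightarrow> (('a \<times> 'b) \<Rightarrow>\<^sub>0 'k) set" where
  "tensor_class M N z =
     span_in (formal_pairs M N) (bilinear_relators M N) +>\<^bsub>formal_pairs M N\<^esub> z"

definition tensor_product ::
  "('k::field, 'a) module \<Rightarrow> ('k, 'b) module \<Rightarrow> ('k, (('a \<times> 'b) \<Rightarrow>\<^sub>0 'k) set) module" where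
  "tensor_product M N =
     quotient_algebra (formal_pairs M N) (span_in (formal_pairs M N) (bilinear_relators M N))"

section \<open>Yetter--Drinfel'd modules of diagonal type and their tensor algebras\<close>

text \<open>
  The abelian group \<open>G\<close> is the type \<open>'g\<close>, written additively. A Yetter--Drinfel'd module \<open>V\<close> of
  diagonal type is given in a canonical basis \<open>x\<^sub>0, ..., x\<^sub>d\<^sub>-\<^sub>1\<close>: \<open>yd_dim\<close> is \<open>d\<close>, the coaction is
  \<open>\<delta>(x\<^sub>i) = yd_deg i \<otimes> x\<^sub>i\<close>, and \<open>g . x\<^sub>j = yd_chr j g x\<^sub>j\<close>. Thus \<open>q\<^sub>i\<^sub>j\<close> is \<open>yd_chr j (yd_deg i)\<close>.
\<close>

record ('g, 'k) diag_yd =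
  yd_dim :: nat
  yd_deg :: "nat \<Rightarrow> 'g"
  yd_chr :: "nat \<Rightarrow> 'g \<Rightarrow> 'k"

definition is_diag_yd :: "('g::ab_group_add, 'k::field) diag_yd \<Rightarrow> bool" where
  "is_diag_yd V \<longleftrightarrow> (\<forall>i<yd_dim V. yd_chr V i 0 = 1 \<and>
     (\<forall>g h. yd_chr V i (g + h) = yd_chr V i g * yd_chr V i h))"

definition dual_yd :: "('g::ab_group_add, 'k::field) diag_yd \<Rightarrow> ('g, 'k) diag_yd" where
  "dual_yd V = \<lparr>yd_dim = yd_dim V, yd_deg = (\<lambda>i. - yd_deg V i),
     yd_chr = (\<lambda>i g. inverse (yd_chr V i g))\<rparr>"

text \<open>
  Words under concatenation form a monoid, so the convolution product of \<open>Poly_Mapping\<close> makes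
  \<open>nat list \<Rightarrow>\<^sub>0 'k\<close> a free associative algebra.
\<close>

instantiation list :: (type) monoid_add
begin

definition zero_list :: "'a list" where "zero_list = []"

definition plus_list :: "'a list \<Rightarrow> 'a list \<Rightarrow> 'a list" where "plus_list = (@)"

instance
  by standard (simp_all add: zero_list_def plus_list_def)

end

type_synonym 'k words = "nat list \<Rightarrow>\<^sub>0 'k"

definition words_of :: "('g, 'k) diag_yd \<Rightarrow> nat list set" where
  "words_of V = lists {..<yd_dim V}"

definition tensor_algebra :: "('g, 'k::field) diag_yd \<Rightarrow> ('k, 'k words) module" where
  "tensor_algebra V = \<lparr>carrier = {p. keys p \<subseteq> words_of V}, mult = (*), one = 1,
     zero = 0, add = (+), smult = scale\<rparr>"

definition word_deg :: "('g::ab_group_add, 'k) diag_yd \<Rightarrow> nat list \<Rightarrow> 'g" where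
  "word_deg V u = sum_list (map (yd_deg V) u)"

definition word_chr :: "('g, 'k::field) diag_yd \<Rightarrow> nat list \<Rightarrow> 'g \<Rightarrow> 'k" where
  "word_chr V u g = prod_list (map (\<lambda>i. yd_chr V i g) u)"

definition g_act :: "('g, 'k::field) diag_yd \<Rightarrow> 'g \<Rightarrow> 'k words \<Rightarrow> 'k words" where
  "g_act V g p = Poly_Mapping.mapp (\<lambda>u c. word_chr V u g * c) p"

definition restrict_words :: "(nat list \<Rightarrow> bool) \<Rightarrow> 'k::field words \<Rightarrow> 'k words" where
  "restrict_words P p = Poly_Mapping.mapp (\<lambda>u c. if P u then c else 0) p"

text \<open>
  The space \<open>kG \<otimes> M\<close> is identified with the finitely supported functions from \<open>G\<close> to \<open>M\<close>, so a
  coaction \<open>\<delta>\<close> is given by its components: \<open>\<delta>(p) = \<Sum>\<^sub>g g \<otimes> g_component V g p\<close>.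
\<close>

definition g_component :: "('g::ab_group_add, 'k::field) diag_yd \<Rightarrow> 'g \<Rightarrow> 'k words \<Rightarrow> 'k words" where
  "g_component V g p = restrict_words (\<lambda>u. word_deg V u = g) p"

section \<open>The braided Hopf algebra structure of the tensor algebra\<close>

text \<open>
  In \<open>T(V) \<otimes> T(V)\<close>, with basis the pairs of words, the braiding gives the product
  \<open>(a \<otimes> b)(a' \<otimes> b') = a (b\<^sub>(\<^sub>-\<^sub>1\<^sub>) . a') \<otimes> b\<^sub>(\<^sub>0\<^sub>) b'\<close>.
\<close>

definition braided_square ::
  "('g::ab_group_add, 'k::field) diag_yd \<Rightarrow> ('k, (nat list \<times> nat list) \<Rightarrow>\<^sub>0 'k) module" where
  "braided_square V =
     \<lparr>carrier = {z. keys z \<subseteq> words_of V \<times> words_of V},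
      mult = (\<lambda>z z'. \<Sum>(u, v)\<in>keys z. \<Sum>(u', v')\<in>keys z'.
        single (u @ u', v @ v')
          (lookup z (u, v) * lookup z' (u', v') * word_chr V u' (word_deg V v))),
      one = single ([], []) 1, zero = 0, add = (+), smult = scale\<rparr>"

primrec comult_word ::
  "('g::ab_group_add, 'k::field) diag_yd \<Rightarrow> nat list \<Rightarrow> ((nat list \<times> nat list) \<Rightarrow>\<^sub>0 'k)" where
  "comult_word V [] = \<one>\<^bsub>braided_square V\<^esub>"
| "comult_word V (i # u) =
     (single ([i], []) 1 + single ([], [i]) 1)
       \<otimes>\<^bsub>braided_square V\<^esub> comult_word V u"

definition comult ::
  "('g::ab_group_add, 'k::field) diag_yd \<Rightarrow> 'k words \<Rightarrow> ((nat list \<times> nat list) \<Rightarrow>\<^sub>0 'k)" where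
  "comult V = lin_ext (comult_word V)"

text \<open>The antipode satisfies \<open>S(a b) = S(a\<^sub>(\<^sub>-\<^sub>1\<^sub>) . b) S(a\<^sub>(\<^sub>0\<^sub>))\<close> and \<open>S(x\<^sub>i) = - x\<^sub>i\<close>.\<close>

primrec antipode_word :: "('g::ab_group_add, 'k::field) diag_yd \<Rightarrow> nat list \<Rightarrow> 'k words" where
  "antipode_word V [] = 1"
| "antipode_word V (i # u) =
     scale (word_chr V u (yd_deg V i)) (antipode_word V u) * (- single [i] 1)"

definition antipode :: "('g::ab_group_add, 'k::field) diag_yd \<Rightarrow> 'k words \<Rightarrow> 'k words" where
  "antipode V = lin_ext (antipode_word V)"

definition tensor_of :: "'k::field words \<Rightarrow> 'k words \<Rightarrow> ((nat list \<times> nat list) \<Rightarrow>\<^sub>0 'k)" where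
  "tensor_of p q =
     (\<Sum>u\<in>keys p. \<Sum>v\<in>keys q. single (u, v) (lookup p u * lookup q v))"

section \<open>Nichols algebras\<close>

text \<open>Hopf ideals are taken in the category of Yetter--Drinfel'd modules.\<close>

definition is_graded_hopf_ideal ::
  "('g::ab_group_add, 'k::field) diag_yd \<Rightarrow> 'k words set \<Rightarrow> bool" where
  "is_graded_hopf_ideal V I \<longleftrightarrow>
     ideal I (tensor_algebra V) \<and>
     (\<forall>p\<in>I. \<forall>m. restrict_words (\<lambda>u. length u = m) p \<in> I) \<and>
     (\<forall>p\<in>I. \<forall>g. g_act V g p \<in> I) \<and>
     (\<forall>p\<in>I. \<forall>g. g_component V g p \<in> I) \<and>
     (\<forall>p\<in>I. comult V p \<in> span_in (braided_square V)
        ({tensor_of a b | a b. a \<in> I \<and> b \<in> carrier (tensor_algebra V)} \<union>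
         {tensor_of a b | a b. a \<in> carrier (tensor_algebra V) \<and> b \<in> I})) \<and>
     (\<forall>p\<in>I. lookup p [] = 0) \<and>
     (\<forall>p\<in>I. antipode V p \<in> I)"

definition generated_in_degrees_ge2 :: "('g, 'k::field) diag_yd \<Rightarrow> 'k words set \<Rightarrow> bool" where
  "generated_in_degrees_ge2 V I \<longleftrightarrow>
     (\<exists>S. S \<subseteq> {p \<in> carrier (tensor_algebra V). \<exists>m\<ge>2. \<forall>u\<in>keys p. length u = m} \<and>
        I = Idl\<^bsub>tensor_algebra V\<^esub> S)"

definition nichols_ideal :: "('g::ab_group_add, 'k::field) diag_yd \<Rightarrow> 'k words set" where
  "nichols_ideal V = (GREATEST I. is_graded_hopf_ideal V I \<and> generated_in_degrees_ge2 V I)"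

definition nichols_algebra ::
  "('g::ab_group_add, 'k::field) diag_yd \<Rightarrow> ('k, 'k words set) module" where
  "nichols_algebra V = quotient_algebra (tensor_algebra V) (nichols_ideal V)"

definition nichols_class :: "('g::ab_group_add, 'k::field) diag_yd \<Rightarrow> 'k words \<Rightarrow> 'k words set" where
  "nichols_class V p = nichols_ideal V +>\<^bsub>tensor_algebra V\<^esub> p"

definition nichols_gen :: "('g::ab_group_add, 'k::field) diag_yd \<Rightarrow> nat \<Rightarrow> 'k words set" where
  "nichols_gen V i = nichols_class V (single [i] 1)"

definition nichols_plus :: "('g::ab_group_add, 'k::field) diag_yd \<Rightarrow> 'k words set set" where
  "nichols_plus V = nichols_class V ` {p \<in> carrier (tensor_algebra V). lookup p [] = 0}"

definition nichols_g_act ::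
  "('g::ab_group_add, 'k::field) diag_yd \<Rightarrow> 'g \<Rightarrow> 'k words set \<Rightarrow> 'k words set" where
  "nichols_g_act V g = induced_map (tensor_algebra V) (nichols_ideal V) (g_act V g)"

definition nichols_coact ::
  "('g::ab_group_add, 'k::field) diag_yd \<Rightarrow> 'k words set \<Rightarrow> 'g \<Rightarrow> 'k words set" where
  "nichols_coact V C g = induced_map (tensor_algebra V) (nichols_ideal V) (g_component V g) C"

definition is_yd_submodule ::
  "('g::ab_group_add, 'k::field) diag_yd \<Rightarrow> 'k words set set \<Rightarrow> bool" where
  "is_yd_submodule V W \<longleftrightarrow> is_subspace (nichols_algebra V) W \<and>
     (\<forall>x\<in>W. \<forall>g. nichols_g_act V g x \<in> W) \<and> (\<forall>x\<in>W. \<forall>g. nichols_coact V x g \<in> W)"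

text \<open>
  \<open>Y\<close> describes \<open>W\<close>, a subspace of the Nichols algebra, as a Yetter--Drinfel'd module of diagonal
  type in the canonical basis \<open>w\<close>.
\<close>

definition is_canonical_basis ::
  "('g::ab_group_add, 'k::field) diag_yd \<Rightarrow> 'k words set set \<Rightarrow> (nat \<Rightarrow> 'k words set) \<Rightarrow>
     ('g, 'k) diag_yd \<Rightarrow> bool" where
  "is_canonical_basis V W w Y \<longleftrightarrow> is_diag_yd Y \<and>
     is_basis (nichols_algebra V) (yd_dim Y) w W \<and>
     (\<forall>i<yd_dim Y. nichols_coact V (w i) =
        (\<lambda>g. if g = yd_deg Y i then w i else \<zero>\<^bsub>nichols_algebra V\<^esub>)) \<and>
     (\<forall>i<yd_dim Y. \<forall>g. nichols_g_act V g (w i) = yd_chr Y i g \<odot>\<^bsub>nichols_algebra V\<^esub> w i)"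

section \<open>The bosonization of the dual Nichols algebra and its action\<close>

text \<open>
  The elements of \<open>M # kG\<close> are the finitely supported functions from \<open>G\<close> to \<open>M\<close>; the argument
  \<open>\<gamma>\<close> is the action of \<open>G\<close> on \<open>M\<close>.
\<close>

definition smash_product ::
  "('k::field, 'a) module \<Rightarrow> ('g::ab_group_add \<Rightarrow> 'a \<Rightarrow> 'a) \<Rightarrow> ('k, 'g \<Rightarrow> 'a) module" where
  "smash_product M \<gamma> =
     \<lparr>carrier = {F. (\<forall>g. F g \<in> carrier M) \<and> finite {g. F g \<noteq> \<zero>\<^bsub>M\<^esub>}},
      mult = (\<lambda>F F' g. \<Oplus>\<^bsub>M\<^esub>h\<in>{h. F h \<noteq> \<zero>\<^bsub>M\<^esub>}. F h \<otimes>\<^bsub>M\<^esub> \<gamma> h (F' (g - h))),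
      one = (\<lambda>g. if g = 0 then \<one>\<^bsub>M\<^esub> else \<zero>\<^bsub>M\<^esub>),
      zero = (\<lambda>_. \<zero>\<^bsub>M\<^esub>),
      add = (\<lambda>F F' g. F g \<oplus>\<^bsub>M\<^esub> F' g),
      smult = (\<lambda>c F g. c \<odot>\<^bsub>M\<^esub> F g)\<rparr>"

definition smash_el :: "('k, 'a) module \<Rightarrow> 'a \<Rightarrow> 'g \<Rightarrow> ('g \<Rightarrow> 'a)" where
  "smash_el M f g = (\<lambda>h. if h = g then f else \<zero>\<^bsub>M\<^esub>)"

definition dual_boson ::
  "('g::ab_group_add, 'k::field) diag_yd \<Rightarrow> ('k, 'g \<Rightarrow> 'k words set) module" where
  "dual_boson V = smash_product (nichols_algebra (dual_yd V)) (nichols_g_act (dual_yd V))"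

definition boson_of ::
  "('g::ab_group_add, 'k::field) diag_yd \<Rightarrow> 'k words set \<Rightarrow> ('g \<Rightarrow> 'k words set)" where
  "boson_of V f = smash_el (nichols_algebra (dual_yd V)) f 0"

definition boson_grp ::
  "('g::ab_group_add, 'k::field) diag_yd \<Rightarrow> 'g \<Rightarrow> ('g \<Rightarrow> 'k words set)" where
  "boson_grp V g = smash_el (nichols_algebra (dual_yd V)) \<one>\<^bsub>nichols_algebra (dual_yd V)\<^esub> g"

definition is_boson_coproduct ::
  "('g::ab_group_add, 'k::field) diag_yd \<Rightarrow>
     (('g \<Rightarrow> 'k words set) \<Rightarrow> ((('g \<Rightarrow> 'k words set) \<times> ('g \<Rightarrow> 'k words set)) \<Rightarrow>\<^sub>0 'k) set) \<Rightarrow> bool" where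
  "is_boson_coproduct V \<Delta> \<longleftrightarrow>
     \<Delta> \<in> alg_hom (dual_boson V) (tensor_product (dual_boson V) (dual_boson V)) \<and>
     (\<forall>i<yd_dim V. \<Delta> (boson_of V (nichols_gen (dual_yd V) i)) =
        tensor_class (dual_boson V) (dual_boson V)
          (single (boson_of V (nichols_gen (dual_yd V) i), \<one>\<^bsub>dual_boson V\<^esub>) 1 +
           single
             (boson_grp V (- yd_deg V i), boson_of V (nichols_gen (dual_yd V) i)) 1)) \<and>
     (\<forall>g. \<Delta> (boson_grp V g) =
        tensor_class (dual_boson V) (dual_boson V)
          (single (boson_grp V g, boson_grp V g) 1))"

definition is_dual_iso ::
  "('g::ab_group_add, 'k::field) diag_yd \<Rightarrow> ('k words set \<Rightarrow> 'k words set) \<Rightarrow> bool" where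
  "is_dual_iso V \<iota> \<longleftrightarrow>
     \<iota> \<in> alg_hom (nichols_algebra V) (nichols_algebra (dual_yd V)) \<and>
     bij_betw \<iota> (carrier (nichols_algebra V)) (carrier (nichols_algebra (dual_yd V))) \<and>
     (\<forall>i<yd_dim V. \<iota> (nichols_gen V i) = nichols_gen (dual_yd V) i)"

text \<open>
  In the last clause, \<open>Z\<close> ranges over the expressions \<open>\<Sum> c (F\<^sub>1 \<otimes> F\<^sub>2)\<close> of \<open>\<Delta>(F)\<close>, so this is
  \<open>\<langle>F, \<rho>\<rho>'\<rangle> = \<langle>F\<^sub>(\<^sub>1\<^sub>), \<rho>\<rangle>\<langle>F\<^sub>(\<^sub>2\<^sub>), \<rho>'\<rangle>\<close>.
\<close>

definition is_nichols_action ::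
  "('g::ab_group_add, 'k::field) diag_yd \<Rightarrow>
     (('g \<Rightarrow> 'k words set) \<Rightarrow> ((('g \<Rightarrow> 'k words set) \<times> ('g \<Rightarrow> 'k words set)) \<Rightarrow>\<^sub>0 'k) set) \<Rightarrow>
     (('g \<Rightarrow> 'k words set) \<Rightarrow> 'k words set \<Rightarrow> 'k words set) \<Rightarrow> bool" where
  "is_nichols_action V \<Delta> act \<longleftrightarrow>
     (let B = nichols_algebra V; H = dual_boson V in
       (\<forall>F\<in>carrier H. \<forall>\<rho>\<in>carrier B. act F \<rho> \<in> carrier B) \<and>
       (\<forall>F\<in>carrier H. \<forall>F'\<in>carrier H. \<forall>\<rho>\<in>carrier B. act (F \<oplus>\<^bsub>H\<^esub> F') \<rho> = act F \<rho> \<oplus>\<^bsub>B\<^esub> act F' \<rho>) \<and>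
       (\<forall>c. \<forall>F\<in>carrier H. \<forall>\<rho>\<in>carrier B. act (c \<odot>\<^bsub>H\<^esub> F) \<rho> = c \<odot>\<^bsub>B\<^esub> act F \<rho>) \<and>
       (\<forall>F\<in>carrier H. \<forall>\<rho>\<in>carrier B. \<forall>\<rho>'\<in>carrier B. act F (\<rho> \<oplus>\<^bsub>B\<^esub> \<rho>') = act F \<rho> \<oplus>\<^bsub>B\<^esub> act F \<rho>') \<and>
       (\<forall>c. \<forall>F\<in>carrier H. \<forall>\<rho>\<in>carrier B. act F (c \<odot>\<^bsub>B\<^esub> \<rho>) = c \<odot>\<^bsub>B\<^esub> act F \<rho>) \<and>
       (\<forall>F\<in>carrier H. \<forall>F'\<in>carrier H. \<forall>\<rho>\<in>carrier B. act (F \<otimes>\<^bsub>H\<^esub> F') \<rho> = act F (act F' \<rho>)) \<and>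
       (\<forall>g. \<forall>\<rho>\<in>carrier B. act (boson_grp V g) \<rho> = nichols_g_act V g \<rho>) \<and>
       (\<forall>i<yd_dim V. \<forall>j<yd_dim V. act (boson_of V (nichols_gen (dual_yd V) i)) (nichols_gen V j) =
          (if i = j then \<one>\<^bsub>B\<^esub> else \<zero>\<^bsub>B\<^esub>)) \<and>
       (\<forall>F\<in>carrier H. \<forall>\<rho>\<in>carrier B. \<forall>\<rho>'\<in>carrier B. \<forall>Z\<in>\<Delta> F.
          act F (\<rho> \<otimes>\<^bsub>B\<^esub> \<rho>') =
          (\<Oplus>\<^bsub>B\<^esub>x\<in>keys Z. lookup Z x \<odot>\<^bsub>B\<^esub> (act (fst x) \<rho> \<otimes>\<^bsub>B\<^esub> act (snd x) \<rho>'))))"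

text \<open>The action of \<open>H \<otimes> H\<close> on \<open>B \<otimes> B\<close>, on the level of formal linear combinations.\<close>

definition tensor_act ::
  "('h \<Rightarrow> 'b \<Rightarrow> 'b) \<Rightarrow> (('h \<times> 'h) \<Rightarrow>\<^sub>0 'k::field) \<Rightarrow> (('b \<times> 'b) \<Rightarrow>\<^sub>0 'k) \<Rightarrow> (('b \<times> 'b) \<Rightarrow>\<^sub>0 'k)" where
  "tensor_act act Z X = (\<Sum>z\<in>keys Z. \<Sum>x\<in>keys X.
     single (act (fst z) (fst x), act (snd z) (snd x)) (lookup Z z * lookup X x))"

text \<open>
  For \<open>f\<close> in the dual Nichols algebra: \<open>\<Delta>(f)\<close> and \<open>f \<otimes> 1 + h\<^sup>-\<^sup>1 \<otimes> f\<close> act in the same way on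
  \<open>A \<otimes> A\<close>, with values in the tensor square of the Nichols algebra.
\<close>

definition skew_primitive_on ::
  "('g::ab_group_add, 'k::field) diag_yd \<Rightarrow>
     (('g \<Rightarrow> 'k words set) \<Rightarrow> ((('g \<Rightarrow> 'k words set) \<times> ('g \<Rightarrow> 'k words set)) \<Rightarrow>\<^sub>0 'k) set) \<Rightarrow>
     (('g \<Rightarrow> 'k words set) \<Rightarrow> 'k words set \<Rightarrow> 'k words set) \<Rightarrow>
     'k words set set \<Rightarrow> 'g \<Rightarrow> 'k words set \<Rightarrow> bool" where
  "skew_primitive_on V \<Delta> act A h f \<longleftrightarrow>
     (\<forall>Z\<in>\<Delta> (boson_of V f). \<forall>X. keys X \<subseteq> A \<times> A \<longrightarrow>
        tensor_class (nichols_algebra V) (nichols_algebra V) (tensor_act act Z X) =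
        tensor_class (nichols_algebra V) (nichols_algebra V)
          (tensor_act act
             (single (boson_of V f, \<one>\<^bsub>dual_boson V\<^esub>) 1 +
              single (boson_grp V (- h), boson_of V f) 1) X))"

end

theory Submission
  imports Defs "HOL.Vector_Spaces"
begin

text \<open>
  On \<open>T(V)\<close> consider the skew derivations \<open>\<partial>\<^sub>i\<close> (\<open>rder\<close>) with \<open>(id \<otimes> x\<^sub>i\<^sup>*) \<circ> \<Delta> = \<partial>\<^sub>i\<close>. The elements all of whose
  iterated derivatives have zero constant term form the largest subspace of the augmentation ideal
  that is stable under all \<open>\<partial>\<^sub>i\<close>, and this subspace (\<open>nulls\<close>) is the Nichols ideal.

  The map \<open>T(W) \<rightarrow> A\<close> sending the letters to the \<open>w\<^sub>i\<close> intertwines \<open>\<lambda>\<^sub>i g\<^sub>i\<^sup>-\<^sup>1 \<partial>\<^sub>i\<close> with \<open>\<langle>\<iota>(w\<^sub>i), \<cdot>\<rangle>\<close>,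
  because both are skew derivations with the same values on generators. Hence its kernel is stable
  under all \<open>\<partial>\<^sub>i\<close>; it lies in the augmentation ideal since \<open>W \<subseteq> B(V)\<^sup>+\<close>. So the kernel is contained in
  the Nichols ideal of \<open>W\<close>, and \<open>A\<close> maps onto \<open>B(W)\<close>.
\<close>

section \<open>Linear combinations\<close>

text \<open>The Nichols ideal is defined as a greatest element, so the radical of the derivations
  must itself be shown to be a Hopf ideal generated in degrees at least 2, besides containing every
  other such ideal. The first point carries most of the work. For the coproduct, tensors killed by
  all pairs of functionals have to be split along the radical. For the antipode, right derivations
  are exchanged with left ones, which is why \<open>lder\<close> appears although the radical is
  defined by \<open>rder\<close> alone.

  The twist by the inverse group element is forced by two conventions: \<open>rder\<close> obeys
  d(pq) = p d(q) + d(p) (g.q), whereas a skew-primitive element acts by d(ab) = d(a) b + (g^{-1}.a)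
  d(b). Applying g^{-1} turns the first rule into the second. The action of g is invertible and the
  scalars are nonzero, so both can be undone, and the kernel is stable under \<open>rder\<close>
  itself.

  Computations take place in the tensor algebras. The basis of W is replaced by arbitrary lifts, so
  identities about it hold only modulo the radical of V.\<close>

lemma lookup_scale [simp]: "lookup (scale c p) x = c * lookup p x"
  by (simp add: scale_def Poly_Mapping.map.rep_eq when_def)

lemma scale_single [simp]: "scale c (single x a) = single x (c * a)"
  by (rule poly_mapping_eqI) (simp add: lookup_single when_def)

interpretation lc: vector_space "scale :: 'k::field \<Rightarrow> ('x \<Rightarrow>\<^sub>0 'k) \<Rightarrow> ('x \<Rightarrow>\<^sub>0 'k)"
  by standard (rule poly_mapping_eqI, simp add: lookup_add algebra_simps)+

abbreviation lin :: "(('x \<Rightarrow>\<^sub>0 'k::field) \<Rightarrow> ('y \<Rightarrow>\<^sub>0 'k)) \<Rightarrow> bool" where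
  "lin \<equiv> module_hom scale scale"

lemma lin_iff: "lin F \<longleftrightarrow> (\<forall>p q. F (p + q) = F p + F q) \<and> (\<forall>c p. F (scale c p) = scale c (F p))"
  by (simp add: module_hom_iff lc.module_axioms)

lemma keys_scale_subset: "keys (scale c p) \<subseteq> keys p"
  by (auto simp: in_keys_iff)

lemma subspace_keys: "lc.subspace {p :: 'a \<Rightarrow>\<^sub>0 'k::field. keys p \<subseteq> S}"
proof -
  have *: "keys p \<subseteq> S \<longleftrightarrow> (\<forall>x. x \<notin> S \<longrightarrow> lookup p x = 0)" for p :: "'a \<Rightarrow>\<^sub>0 'k"
    by (auto simp: in_keys_iff subset_iff)
  show ?thesis unfolding lc.subspace_def by (simp add: * lookup_add del: keys_zero)
qed

lemma sum_scale_single: "p = (\<Sum>x\<in>keys p. scale (lookup p x) (single x 1))"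
proof (rule poly_mapping_eqI)
  fix y
  have "lookup (\<Sum>x\<in>keys p. scale (lookup p x) (single x 1)) y =
      (\<Sum>x\<in>keys p. if x = y then lookup p x else 0)"
    by (auto simp: lookup_sum lookup_single when_def intro: sum.cong)
  then show "lookup p y = lookup (\<Sum>x\<in>keys p. scale (lookup p x) (single x 1)) y"
    by (simp add: in_keys_iff)
qed

lemma words_induct [consumes 1, case_names single add scale]:
  assumes p: "keys p \<subseteq> S"
    and single: "\<And>x. x \<in> S \<Longrightarrow> P (single x (1::'k::field))"
    and add: "\<And>p q. keys p \<subseteq> S \<Longrightarrow> keys q \<subseteq> S \<Longrightarrow> P p \<Longrightarrow> P q \<Longrightarrow> P (p + q)"
    and scale: "\<And>c p. keys p \<subseteq> S \<Longrightarrow> P p \<Longrightarrow> P (scale c p)"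
    and S: "S \<noteq> {}"
  shows "P p"
proof -
  obtain x where x: "x \<in> S" using S by auto
  \<comment> \<open>The zero combination is reached as 0 times a basis vector; this is where
    nonemptiness of \<open>S\<close> enters.\<close>
  have P0: "P 0" using scale[of "single x 1" 0] single[OF x] x by simp
  have *: "keys (\<Sum>x\<in>X. scale (lookup p x) (single x 1)) \<subseteq> S \<and>
      P (\<Sum>x\<in>X. scale (lookup p x) (single x 1))" if "finite X" "X \<subseteq> S" for X
    using that
  proof (induction X)
    case (insert x X)
    let ?q = "scale (lookup p x) (single x 1)"
    let ?r = "\<Sum>x\<in>X. scale (lookup p x) (single x 1)"
    have q: "keys ?q \<subseteq> S" "P ?q"
      using insert.prems scale[of "single x 1" "lookup p x"] single[of x] by auto
    moreover have "keys (?q + ?r) \<subseteq> S"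
      using insert q(1) Poly_Mapping.keys_add[of ?q ?r] by blast
    ultimately show ?case using insert add[of ?q ?r] by simp
  qed (simp add: P0)
  from *[of "keys p"] p show ?thesis using sum_scale_single[of p] by simp
qed

text \<open>Reduces most identities below to single words, where induction on the first letter
  applies. The set \<open>S\<close> admits identities that hold only for words in the letters of a
  given module.\<close>

lemma lin_eq_on:
  assumes "lin F" "lin G" "keys p \<subseteq> S" "\<And>x. x \<in> S \<Longrightarrow> F (single x 1) = G (single x 1)"
  shows "F p = G p"
proof -
  have "F (\<Sum>x\<in>keys p. scale (lookup p x) (single x 1)) = G (\<Sum>x\<in>keys p. scale (lookup p x) (single x 1))"
    unfolding module_hom.sum[OF assms(1)] module_hom.sum[OF assms(2)]
      module_hom.scale[OF assms(1)] module_hom.scale[OF assms(2)]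
    using assms(3,4) by (intro sum.cong) auto
  then show ?thesis using sum_scale_single[of p] by simp
qed

lemma lin_eqI:
  assumes "lin F" "lin G" "\<And>x. F (single x 1) = G (single x 1)"
  shows "F = G"
  using lin_eq_on[of F G _ UNIV] assms by auto

lemma functional_eqI:
  fixes f g :: "('x \<Rightarrow>\<^sub>0 'k::field) \<Rightarrow> 'k"
  assumes "\<And>p q. f (p + q) = f p + f q" "\<And>c p. f (scale c p) = c * f p"
    and "\<And>p q. g (p + q) = g p + g q" "\<And>c p. g (scale c p) = c * g p"
    and "\<And>x. f (single x 1) = g (single x 1)"
  shows "f p = g p"
proof -
  \<comment> \<open>Scalars are identified with combinations over a one-point set, so that
    functionals become linear maps.\<close>
  have "(\<lambda>p. single () (f p)) = (\<lambda>p. single () (g p))"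
    by (rule lin_eqI) (simp_all add: lin_iff assms single_add)
  then show ?thesis by (metis lookup_single_eq)
qed

lemma lin_mem:
  assumes "lin F" "lc.subspace U" "keys p \<subseteq> S" "\<And>x. x \<in> S \<Longrightarrow> F (single x 1) \<in> U"
  shows "F p \<in> U"
proof -
  have "F (\<Sum>x\<in>keys p. scale (lookup p x) (single x 1)) \<in> U"
    unfolding module_hom.sum[OF assms(1)] module_hom.scale[OF assms(1)]
    using assms by (intro lc.subspace_sum lc.subspace_scale) auto
  then show ?thesis using sum_scale_single[of p] by simp
qed

lemma lin_keys:
  assumes "lin F" "keys p \<subseteq> S" "\<And>x. x \<in> S \<Longrightarrow> keys (F (single x 1)) \<subseteq> U"
  shows "keys (F p) \<subseteq> U"
  using lin_mem[OF assms(1) subspace_keys assms(2), of U] assms(3) by simp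

lemma lin_ext_single [simp]: "lin_ext f (single x c) = scale c (f x)"
  by (simp add: lin_ext_def)

text \<open>The support of a sum can shrink by cancellation; over a common finite superset all sums
  have the same index set.\<close>

lemma lin_ext_superset:
  assumes "finite X" "keys p \<subseteq> X"
  shows "lin_ext f p = (\<Sum>x\<in>X. scale (lookup p x) (f x))"
  unfolding lin_ext_def using assms by (intro sum.mono_neutral_left) (auto simp: in_keys_iff)

lemma lin_ext_add [simp]: "lin_ext f (p + q) = lin_ext f p + lin_ext f q"
proof -
  let ?X = "keys p \<union> keys q"
  have "keys (p + q) \<subseteq> ?X" by (rule Poly_Mapping.keys_add)
  then show ?thesis
    by (simp add: lin_ext_superset[of ?X] lookup_add lc.scale_left_distrib sum.distrib)
qed

lemma lin_ext_scale [simp]: "lin_ext f (scale c p) = scale c (lin_ext f p)"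
  using lin_ext_superset[OF finite_keys keys_scale_subset, of f c p]
  by (simp add: lin_ext_def lc.scale_sum_right)

lemma lin_lin_ext [simp]: "lin (lin_ext f)"
  by (simp add: lin_iff)

lemma lin_ext_zero [simp]: "lin_ext f 0 = 0"
  by (simp add: lin_ext_def)

lemma lin_ext_diff [simp]: "lin_ext f (p - q) = lin_ext f p - lin_ext f q"
  by (rule module_hom.diff[OF lin_lin_ext])

section \<open>Words\<close>

lemma single_mult_single: "single u a * single v b = single (u @ v) (a * (b::'k::field))"
  by (simp add: mult_single plus_list_def)

lemma one_words: "(1::'k::field words) = single [] 1"
  by (simp add: zero_list_def flip: single_one)

lemma sum_mult_single:
  "p * q = (\<Sum>u\<in>keys p. \<Sum>v\<in>keys q. single (u @ v) (lookup p u * lookup q v :: 'k::field))"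
proof -
  have "p * q = (\<Sum>x\<in>keys p. scale (lookup p x) (single x 1)) * (\<Sum>x\<in>keys q. scale (lookup q x) (single x 1))"
    using sum_scale_single[of p] sum_scale_single[of q] by simp
  then show ?thesis by (simp add: sum_product single_mult_single)
qed

lemma mult_words_superset:
  assumes "finite X" "finite Z" "keys p \<subseteq> X" "keys q \<subseteq> Z"
  shows "p * q = (\<Sum>u\<in>X. \<Sum>v\<in>Z. single (u @ v) (lookup p u * lookup q v :: 'k::field))"
proof -
  have "(\<Sum>u\<in>X. \<Sum>v\<in>Z. single (u @ v) (lookup p u * lookup q v)) =
      (\<Sum>u\<in>keys p. \<Sum>v\<in>Z. single (u @ v) (lookup p u * lookup q v))"
    using assms by (intro sum.mono_neutral_right) (auto simp: in_keys_iff)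
  also have "\<dots> = p * q"
    unfolding sum_mult_single using assms
    by (intro sum.cong sum.mono_neutral_right) (auto simp: in_keys_iff)
  finally show ?thesis ..
qed

lemma mult_scale_left [simp]: "scale c p * q = scale c (p * q :: 'k::field words)"
  using mult_words_superset[of "keys p" "keys q" "scale c p" q]
  by (simp add: keys_scale_subset sum_mult_single lc.scale_sum_right mult.assoc)

lemma mult_scale_right [simp]: "p * scale c q = scale c (p * q :: 'k::field words)"
  using mult_words_superset[of "keys p" "keys q" p "scale c q"]
  by (simp add: keys_scale_subset sum_mult_single lc.scale_sum_right mult.left_commute)

lemma bilin_eqI:
  assumes "\<And>q. lin (\<lambda>p. F p q)" "\<And>p. lin (\<lambda>q. F p q)"
    and "\<And>q. lin (\<lambda>p. G p q)" "\<And>p. lin (\<lambda>q. G p q)"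
    and eq: "\<And>u v. F (single u 1) (single v 1) = G (single u 1) (single v 1)"
  shows "F p q = G p q"
proof -
  have "F (single u 1) q = G (single u 1) q" for u
    using lin_eqI[OF assms(2,4), of "single u 1" "single u 1"] eq by metis
  then show ?thesis using lin_eqI[OF assms(1,3), of q q] by metis
qed

lemma single_Nil_mult [simp]: "single [] 1 * p = p" "p * single [] 1 = p" for p :: "'k::field words"
  by (simp_all flip: one_words)

text \<open>Only empty words concatenate to the empty word, so the constant term (the counit) is
  multiplicative.\<close>

lemma lookup_mult_Nil: "lookup (p * q) [] = lookup p [] * lookup q [] " for p q :: "'k::field words"
proof -
  have "single [] (lookup (p * q) []) = single [] (lookup p [] * lookup q [])"
    by (rule bilin_eqI[where F = "\<lambda>p q. single [] (lookup (p * q) [])"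
          and G = "\<lambda>p q. single [] (lookup p [] * lookup q [])"])
      (auto simp: lin_iff lookup_add algebra_simps single_add lookup_single when_def single_mult_single)
  then show ?thesis by (metis lookup_single_eq)
qed

lemma lookup_letter_mult [simp]: "lookup (single [j] 1 * p) [] = 0" for p :: "'k::field words"
  by (simp add: lookup_mult_Nil lookup_single)

lemma keys_mult_words:
  assumes "keys p \<subseteq> lists S" "keys q \<subseteq> lists S"
  shows "keys (p * q :: 'k::field words) \<subseteq> lists S"
proof -
  have "keys (single u 1 * q) \<subseteq> lists S" if "u \<in> lists S" for u
    by (rule lin_keys[OF _ assms(2), where F = "\<lambda>q. single u 1 * q"])
      (use that in \<open>auto simp: lin_iff distrib_left single_mult_single\<close>)
  then show ?thesis
    by (intro lin_keys[OF _ assms(1), where F = "\<lambda>p. p * q"]) (auto simp: lin_iff distrib_right)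
qed

lemma keys_mult_words_of:
  "keys p \<subseteq> words_of V \<Longrightarrow> keys q \<subseteq> words_of V \<Longrightarrow> keys (p * q :: 'k::field words) \<subseteq> words_of V"
  unfolding words_of_def by (rule keys_mult_words)

lemma keys_add_le: "keys p \<subseteq> S \<Longrightarrow> keys q \<subseteq> S \<Longrightarrow> keys (p + q :: 'x \<Rightarrow>\<^sub>0 'k::field) \<subseteq> S"
  using lc.subspace_add[OF subspace_keys[of S], of p q] by simp

lemma keys_diff_le: "keys p \<subseteq> S \<Longrightarrow> keys q \<subseteq> S \<Longrightarrow> keys (p - q :: 'x \<Rightarrow>\<^sub>0 'k::field) \<subseteq> S"
  using lc.subspace_diff[OF subspace_keys[of S], of p q] by simp

lemma keys_scale_le: "keys p \<subseteq> S \<Longrightarrow> keys (scale c p) \<subseteq> S"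
  using lc.subspace_scale[OF subspace_keys[of S], of p c] by simp

section \<open>Words of a module, the group action on them and graded components\<close>

lemma words_of_simps [simp]:
  "[] \<in> words_of V" "j # u \<in> words_of V \<longleftrightarrow> j < yd_dim V \<and> u \<in> words_of V"
  "u @ v \<in> words_of V \<longleftrightarrow> u \<in> words_of V \<and> v \<in> words_of V"
  by (auto simp: words_of_def)

lemma word_chr_simps [simp]:
  "word_chr V [] g = 1" "word_chr V (j # u) g = yd_chr V j g * word_chr V u g"
  "word_chr V (u @ v) g = word_chr V u g * word_chr V v g"
  by (simp_all add: word_chr_def)

lemma word_deg_simps [simp]:
  "word_deg V [] = 0" "word_deg V (j # u) = yd_deg V j + word_deg V u"
  by (simp_all add: word_deg_def)

lemma word_chr_zero: "is_diag_yd V \<Longrightarrow> u \<in> words_of V \<Longrightarrow> word_chr V u 0 = 1"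
  by (induction u) (auto simp: is_diag_yd_def)

lemma word_chr_add:
  "is_diag_yd V \<Longrightarrow> u \<in> words_of V \<Longrightarrow> word_chr V u (g + h) = word_chr V u g * word_chr V u h"
  by (induction u) (auto simp: is_diag_yd_def)

lemma lookup_g_act [simp]: "lookup (g_act V g p) u = word_chr V u g * lookup p u"
  by (simp add: g_act_def lookup_mapp when_def in_keys_iff)

lemma g_act_simps [simp]:
  "g_act V g (p + q) = g_act V g p + g_act V g q" "g_act V g (scale c p) = scale c (g_act V g p)"
  "g_act V g 0 = 0"
  "g_act V g (p - q) = g_act V g p - g_act V g q"
  by (rule poly_mapping_eqI; simp add: lookup_add lookup_minus lookup_single when_def algebra_simps)+

lemma g_act_single: "g_act V g (single u c) = single u (word_chr V u g * c)"
  by (rule poly_mapping_eqI) (simp add: lookup_single when_def)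

lemma g_act_mult: "g_act V g (p * q) = g_act V g p * g_act V g q"
  by (rule bilin_eqI[where F = "\<lambda>p q. g_act V g (p * q)"])
    (auto simp: lin_iff algebra_simps g_act_single single_mult_single)

lemma g_act_letter:
  "g_act V g (single [j] 1 * p) = scale (yd_chr V j g) (single [j] 1 * g_act V g p)"
  using mult_scale_left[of "yd_chr V j g" "single [j] 1"] by (simp add: g_act_mult g_act_single)

lemma g_act_commute: "g_act V g (g_act V h p) = g_act V h (g_act V g p)"
  by (rule poly_mapping_eqI) (simp add: mult.left_commute)

lemma keys_g_act: "keys p \<subseteq> S \<Longrightarrow> keys (g_act V g p) \<subseteq> S"
  by (auto simp: in_keys_iff)

lemma g_act_comp:
  "is_diag_yd V \<Longrightarrow> keys p \<subseteq> words_of V \<Longrightarrow> g_act V g (g_act V h p) = g_act V (g + h) p"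
  by (rule lin_eq_on[where S = "words_of V"]) (auto simp: lin_iff word_chr_add g_act_single)

lemma g_act_zero:
  "is_diag_yd V \<Longrightarrow> keys p \<subseteq> words_of V \<Longrightarrow> g_act V 0 p = p"
  by (rule lin_eq_on[where S = "words_of V" and G = "\<lambda>x. x"]) (auto simp: lin_iff word_chr_zero g_act_single)

lemma lookup_restrict_words [simp]: "lookup (restrict_words P p) u = (if P u then lookup p u else 0)"
  by (simp add: restrict_words_def lookup_mapp when_def in_keys_iff)

lemma restrict_words_simps [simp]:
  "restrict_words P (p + q) = restrict_words P p + restrict_words P q"
  "restrict_words P (scale c p) = scale c (restrict_words P p)"
  "restrict_words P (single u c) = (if P u then single u c else 0)"
  by (rule poly_mapping_eqI; auto simp: lookup_add lookup_single when_def)+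

lemma keys_restrict_words: "keys p \<subseteq> S \<Longrightarrow> keys (restrict_words P p) \<subseteq> S"
  by (auto simp: in_keys_iff split: if_splits)

lemma restrict_words_id: "(\<And>u. u \<in> keys p \<Longrightarrow> P u) \<Longrightarrow> restrict_words P p = p"
  by (rule poly_mapping_eqI) (auto simp: in_keys_iff)

lemma restrict_words_none: "(\<And>u. u \<in> keys p \<Longrightarrow> \<not> P u) \<Longrightarrow> restrict_words P p = 0"
  by (rule poly_mapping_eqI) (auto simp: in_keys_iff)

section \<open>Skew derivations\<close>

text \<open>The right braided derivative. In the coproduct of \<open>x_j u\<close> a second factor
  \<open>x_i\<close> comes either from \<open>u\<close> or from the first letter; in the latter case
  it has been braided past all of \<open>u\<close>, hence the group action on
  \<open>u\<close>.\<close>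

primrec rder_word :: "('g, 'k::field) diag_yd \<Rightarrow> nat \<Rightarrow> nat list \<Rightarrow> 'k words" where
  "rder_word V i [] = 0"
| "rder_word V i (j # u) = single [j] 1 * rder_word V i u +
     (if i = j then g_act V (yd_deg V i) (single u 1) else 0)"

definition rder :: "('g, 'k::field) diag_yd \<Rightarrow> nat \<Rightarrow> 'k words \<Rightarrow> 'k words" where
  "rder V i = lin_ext (rder_word V i)"

text \<open>The left counterpart, splitting off a first factor \<open>x_i\<close> of the coproduct:
  either \<open>x_i\<close> is the first letter, or it comes from the rest and \<open>x_j\<close>
  has been braided past it, which costs the factor q_ji.\<close>

primrec lder_word :: "('g, 'k::field) diag_yd \<Rightarrow> nat \<Rightarrow> nat list \<Rightarrow> 'k words" where
  "lder_word V i [] = 0"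
| "lder_word V i (j # u) = (if i = j then single u 1 else 0) +
     scale (yd_chr V i (yd_deg V j)) (single [j] 1 * lder_word V i u)"

definition lder :: "('g, 'k::field) diag_yd \<Rightarrow> nat \<Rightarrow> 'k words \<Rightarrow> 'k words" where
  "lder V i = lin_ext (lder_word V i)"

lemma rder_simps [simp]:
  "rder V i (p + q) = rder V i p + rder V i q" "rder V i (scale c p) = scale c (rder V i p)"
  "rder V i 0 = 0" "rder V i (single [] c) = 0" "rder V i (p - q) = rder V i p - rder V i q"
  by (simp_all add: rder_def)

lemma lder_simps [simp]:
  "lder V i (p + q) = lder V i p + lder V i q" "lder V i (scale c p) = scale c (lder V i p)"
  "lder V i 0 = 0" "lder V i (single [] c) = 0" "lder V i (p - q) = lder V i p - lder V i q"
  by (simp_all add: lder_def)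

lemma single_Cons: "single (j # u) 1 = single [j] 1 * single u (1::'k::field)"
  by (simp add: single_mult_single)

lemma rder_letter: "rder V i (single [j] 1 * p) =
    single [j] 1 * rder V i p + (if i = j then g_act V (yd_deg V i) p else 0)"
  by (rule lin_eq_on[where S = UNIV and F = "\<lambda>p. rder V i (single [j] 1 * p)"])
    (auto simp: lin_iff algebra_simps lc.scale_right_distrib, simp_all add: rder_def single_mult_single)

lemma lder_letter: "lder V i (single [j] 1 * p) =
    (if i = j then p else 0) + scale (yd_chr V i (yd_deg V j)) (single [j] 1 * lder V i p)"
  by (rule lin_eq_on[where S = UNIV and F = "\<lambda>p. lder V i (single [j] 1 * p)"])
    (auto simp: lin_iff algebra_simps lc.scale_right_distrib, simp_all add: lder_def single_mult_single)

text \<open>Skew Leibniz rule, by induction on the first factor; \<open>g_act_mult\<close>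
  distributes the twist over the letters that follow.\<close>

lemma rder_mult: "rder V i (p * q) = p * rder V i q + rder V i p * g_act V (yd_deg V i) q"
proof -
  have word: "rder V i (single u 1 * q) =
      single u 1 * rder V i q + rder V i (single u 1) * g_act V (yd_deg V i) q" for u
  proof (induction u)
    case (Cons j u)
    then show ?case
      unfolding single_Cons[of j u] mult.assoc rder_letter
      by (simp add: algebra_simps g_act_mult)
  qed simp
  show ?thesis
    by (rule lin_eq_on[where S = UNIV and F = "\<lambda>p. rder V i (p * q)"])
      (auto simp: word lin_iff algebra_simps lc.scale_right_distrib)
qed

lemma keys_rder: "keys p \<subseteq> words_of V \<Longrightarrow> keys (rder V i p) \<subseteq> words_of V"
proof (rule lin_keys[where F = "rder V i"])
  fix u assume "u \<in> words_of V"
  then show "keys (rder V i (single u 1)) \<subseteq> words_of V"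
  proof (induction u)
    case (Cons j u)
    then show ?case unfolding single_Cons[of j u] rder_letter
      by (intro keys_add_le keys_mult_words_of) (auto intro!: keys_g_act)
  qed simp
qed (simp add: lin_iff)

lemma keys_lder: "keys p \<subseteq> words_of V \<Longrightarrow> keys (lder V i p) \<subseteq> words_of V"
proof (rule lin_keys[where F = "lder V i"])
  fix u assume "u \<in> words_of V"
  then show "keys (lder V i (single u 1)) \<subseteq> words_of V"
  proof (induction u)
    case (Cons j u)
    then show ?case unfolding single_Cons[of j u] lder_letter
      by (intro keys_add_le keys_scale_le keys_mult_words_of) auto
  qed simp
qed (simp add: lin_iff)

text \<open>A derivative in direction \<open>i\<close> deletes one letter \<open>i\<close>, so the
  weights before and after differ by the character of that letter.\<close>

lemma rder_g_act: "rder V i (g_act V g p) = scale (yd_chr V i g) (g_act V g (rder V i p))"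
proof (rule lin_eq_on[where S = UNIV and F = "\<lambda>p. rder V i (g_act V g p)"])
  fix u
  show "rder V i (g_act V g (single u 1)) = scale (yd_chr V i g) (g_act V g (rder V i (single u 1)))"
  proof (induction u)
    case (Cons j u)
    then show ?case unfolding single_Cons[of j u] g_act_letter
      by (simp add: rder_letter g_act_letter g_act_commute[of V g] algebra_simps lc.scale_right_distrib)
  qed (simp add: g_act_single)
qed (auto simp: lin_iff lc.scale_right_distrib)

lemma lder_g_act: "lder V i (g_act V g p) = scale (yd_chr V i g) (g_act V g (lder V i p))"
proof (rule lin_eq_on[where S = UNIV and F = "\<lambda>p. lder V i (g_act V g p)"])
  fix u
  show "lder V i (g_act V g (single u 1)) = scale (yd_chr V i g) (g_act V g (lder V i (single u 1)))"
  proof (induction u)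
    case (Cons j u)
    then show ?case unfolding single_Cons[of j u] g_act_letter
      by (simp add: lder_letter g_act_letter algebra_simps lc.scale_right_distrib)
  qed (simp add: g_act_single)
qed (auto simp: lin_iff lc.scale_right_distrib)

text \<open>A form of coassociativity: the two derivations split off factors at opposite ends of the
  iterated coproduct.\<close>

lemma lder_rder: "lder V i (rder V j p) = rder V j (lder V i p)"
proof (rule lin_eq_on[where S = UNIV and F = "\<lambda>p. lder V i (rder V j p)"])
  fix u
  show "lder V i (rder V j (single u 1)) = rder V j (lder V i (single u 1))"
  proof (induction u)
    case (Cons k u)
    then show ?case unfolding single_Cons[of k u] lder_letter rder_letter lder_simps rder_simps
      by (auto simp: lder_letter rder_letter lder_g_act g_act_letter algebra_simps lc.scale_right_distrib)
  qed simp
qed (auto simp: lin_iff)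

text \<open>Derivatives shorten words by one, so constants arise only from single letters, and on
  these left and right derivatives agree. \<open>nulls_lder\<close> rests on this
  coincidence.\<close>

lemma lookup_rder_Nil: "lookup (rder V i p) [] = lookup p [i]"
proof (rule functional_eqI[where f = "\<lambda>p. lookup (rder V i p) []" and g = "\<lambda>p. lookup p [i]"])
  fix u
  show "lookup (rder V i (single u 1)) [] = lookup (single u 1) [i]"
  proof (cases u)
    case (Cons k v)
    then show ?thesis unfolding Cons single_Cons[of k v] rder_letter
      by (auto simp: lookup_add lookup_single when_def single_mult_single)
  qed (simp add: lookup_single)
qed (simp_all add: lookup_add)

lemma lookup_lder_Nil: "lookup (lder V i p) [] = lookup p [i]"
proof (rule functional_eqI[where f = "\<lambda>p. lookup (lder V i p) []" and g = "\<lambda>p. lookup p [i]"])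
  fix u
  show "lookup (lder V i (single u 1)) [] = lookup (single u 1) [i]"
  proof (cases u)
    case (Cons k v)
    then show ?thesis unfolding Cons single_Cons[of k v] lder_letter
      by (auto simp: lookup_add lookup_single when_def single_mult_single)
  qed (simp add: lookup_single)
qed (simp_all add: lookup_add)

text \<open>\<open>nulls\<close> tests with all natural numbers as indices, whereas only those below
  the dimension are letters. This disposes of the others.\<close>

lemma rder_eq_zero:
  assumes "keys p \<subseteq> words_of V" "\<not> i < yd_dim V"
  shows "rder V i p = 0"
proof (rule lin_eq_on[where S = "words_of V" and F = "rder V i" and G = "\<lambda>_. 0"])
  fix u assume "u \<in> words_of V"
  then show "rder V i (single u 1) = 0"
  proof (induction u)
    case (Cons j u)
    then show ?case unfolding single_Cons[of j u] rder_letter using assms(2) by auto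
  qed simp
qed (use assms in \<open>auto simp: lin_iff\<close>)

text \<open>Derivations map homogeneous parts to homogeneous parts, for any grading in which they
  have a degree; used for word length and for the grading by the group.\<close>

lemma rder_restrict:
  assumes "\<And>u v. u \<in> keys p \<Longrightarrow> v \<in> keys (rder V i (single u 1)) \<Longrightarrow> P u \<longleftrightarrow> Q v"
  shows "rder V i (restrict_words P p) = restrict_words Q (rder V i p)"
proof (rule lin_eq_on[where S = "keys p" and F = "\<lambda>p. rder V i (restrict_words P p)"])
  fix u assume "u \<in> keys p"
  then show "rder V i (restrict_words P (single u 1)) = restrict_words Q (rder V i (single u 1))"
    using assms[of u] by (cases "P u") (auto simp: restrict_words_id restrict_words_none)
qed (auto simp: lin_iff)

lemma rder_degrees:
  assumes "v \<in> keys (rder V i (single u 1))"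
  shows "length u = Suc (length v) \<and> word_deg V u = yd_deg V i + word_deg V v"
proof -
  have "keys (rder V i (single u 1)) \<subseteq>
      {v. length u = Suc (length v) \<and> word_deg V u = yd_deg V i + word_deg V v}" (is "_ \<subseteq> ?S u")
  proof (induction u)
    case (Cons j u)
    have "keys (single [j] 1 * rder V i (single u 1)) \<subseteq> ?S (j # u)"
      by (rule lin_keys[OF _ Cons.IH, where F = "\<lambda>q. single [j] 1 * q"])
        (auto simp: lin_iff distrib_left add.left_commute single_mult_single)
    then show ?case unfolding single_Cons[of j u] rder_letter
      by (intro keys_add_le) (auto simp: g_act_single split: if_splits)
  qed simp
  then show ?thesis using assms by auto
qed

section \<open>The radical of the derivations\<close>

text \<open>Written with iterated derivatives, membership is a family of linear conditions, one
  functional for each index word \<open>s\<close>; \<open>nulls_coinduct\<close> recovers the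
  description as a largest stable set.\<close>

definition nulls :: "('g, 'k::field) diag_yd \<Rightarrow> 'k words set" where
  "nulls V = {p. keys p \<subseteq> words_of V \<and> (\<forall>s. lookup (fold (rder V) s p) [] = 0)}"

lemma fold_rder_add [simp]: "fold (rder V) s (p + q) = fold (rder V) s p + fold (rder V) s q"
  by (induction s arbitrary: p q) simp_all

lemma fold_rder_scale [simp]: "fold (rder V) s (scale c p) = scale c (fold (rder V) s p)"
  by (induction s arbitrary: p) simp_all

lemma nulls_keys: "p \<in> nulls V \<Longrightarrow> keys p \<subseteq> words_of V"
  by (simp add: nulls_def)

lemma nulls_Nil: "p \<in> nulls V \<Longrightarrow> lookup p [] = 0"
  unfolding nulls_def by (metis (mono_tags, lifting) fold_simps(1) mem_Collect_eq)

lemma nulls_rder: "p \<in> nulls V \<Longrightarrow> rder V i p \<in> nulls V"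
  unfolding nulls_def using keys_rder by (auto dest: spec[of _ "i # _"])

text \<open>All iterated derivatives of \<open>p\<close> stay in \<open>S\<close> and so have zero
  constant term. The set \<open>S\<close> need not be a subspace, which keeps the witnesses below
  simple.\<close>

lemma nulls_coinduct:
  assumes "p \<in> S" "\<And>q. q \<in> S \<Longrightarrow> keys q \<subseteq> words_of V \<and> lookup q [] = 0 \<and> (\<forall>i. rder V i q \<in> S)"
  shows "p \<in> nulls V"
proof -
  have "\<forall>q\<in>S. lookup (fold (rder V) s q) [] = 0" for s
    by (induction s) (use assms(2) in auto)
  then show ?thesis using assms by (auto simp: nulls_def)
qed

lemma nulls_fold_rder: "p \<in> nulls V \<Longrightarrow> fold (rder V) s p \<in> nulls V"
  by (induction s arbitrary: p) (simp_all add: nulls_rder)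

lemma subspace_nulls: "lc.subspace (nulls V)"
  unfolding lc.subspace_def
proof (intro conjI ballI allI)
  show "0 \<in> nulls V" by (rule nulls_coinduct[of _ "{0}"]) auto
next
  fix p q assume "p \<in> nulls V" "q \<in> nulls V"
  then show "p + q \<in> nulls V" by (simp add: nulls_def keys_add_le lookup_add)
next
  fix c p assume "p \<in> nulls V"
  then show "scale c p \<in> nulls V" by (simp add: nulls_def keys_scale_le)
qed

lemmas nulls_zero = lc.subspace_0[OF subspace_nulls]
  and nulls_add = lc.subspace_add[OF subspace_nulls]
  and nulls_diff = lc.subspace_diff[OF subspace_nulls]
  and nulls_neg = lc.subspace_neg[OF subspace_nulls]
  and nulls_scale = lc.subspace_scale[OF subspace_nulls]

lemma nulls_g_act: "p \<in> nulls V \<Longrightarrow> g_act V g p \<in> nulls V"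
\<comment> \<open>Scalar multiples are included because differentiating \<open>g_act V g q\<close>
  produces a character value.\<close>
proof (rule nulls_coinduct[of _ "{scale c (g_act V g q) | c q. q \<in> nulls V}"])
  assume "p \<in> nulls V"
  then show "g_act V g p \<in> {scale c (g_act V g q) | c q. q \<in> nulls V}"
    by (intro CollectI exI[of _ 1] exI[of _ p]) simp
next
  fix r assume "r \<in> {scale c (g_act V g q) | c q. q \<in> nulls V}"
  then obtain c q where r: "r = scale c (g_act V g q)" "q \<in> nulls V" by blast
  then show "keys r \<subseteq> words_of V \<and> lookup r [] = 0 \<and>
      (\<forall>i. rder V i r \<in> {scale c (g_act V g q) | c q. q \<in> nulls V})"
    using nulls_rder[OF r(2)] nulls_keys[OF r(2)] nulls_Nil[OF r(2)]
    by (auto simp: rder_g_act intro!: keys_scale_le keys_g_act)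
qed

text \<open>The image of the radical under a left derivation is stable under right derivations,
  since the two commute. Its constant terms are linear coefficients, which are also constant terms
  of right derivatives and hence vanish.\<close>

lemma nulls_lder: "p \<in> nulls V \<Longrightarrow> lder V i p \<in> nulls V"
proof (rule nulls_coinduct[of _ "lder V i ` nulls V"])
  fix r assume "r \<in> lder V i ` nulls V"
  then obtain q where q: "q \<in> nulls V" "r = lder V i q" by blast
  have "lookup r [] = lookup (rder V i q) []" using q by (simp add: lookup_lder_Nil lookup_rder_Nil)
  then show "keys r \<subseteq> words_of V \<and> lookup r [] = 0 \<and> (\<forall>j. rder V j r \<in> lder V i ` nulls V)"
    using q nulls_rder[OF q(1)] nulls_Nil[OF nulls_rder[OF q(1)]] keys_lder[OF nulls_keys[OF q(1)]]
    by (auto simp flip: lder_rder)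
qed simp

text \<open>By the Leibniz rule a derivative of the product is a sum of two products, each with a
  factor in the radical. As sums appear, induction on the index word with both factors generalized
  is more convenient than coinduction.\<close>

lemma nulls_mult_left:
  assumes "p \<in> nulls V" "keys a \<subseteq> words_of V"
  shows "a * p \<in> nulls V"
proof -
  have "lookup (fold (rder V) s (a * p)) [] = 0" for s
    using assms
  proof (induction s arbitrary: a p)
    case (Cons i s)
    have "lookup (fold (rder V) s (a * rder V i p)) [] = 0"
      "lookup (fold (rder V) s (rder V i a * g_act V (yd_deg V i) p)) [] = 0"
      using Cons by (simp_all add: keys_rder nulls_g_act nulls_rder)
    then show ?case by (simp add: rder_mult lookup_add)
  qed (simp add: lookup_mult_Nil nulls_Nil)
  then show ?thesis using assms by (simp add: nulls_def keys_mult_words_of)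
qed

lemma nulls_mult_right:
  assumes "p \<in> nulls V" "keys a \<subseteq> words_of V"
  shows "p * a \<in> nulls V"
proof -
  have "lookup (fold (rder V) s (p * a)) [] = 0" for s
    using assms
  proof (induction s arbitrary: a p)
    case (Cons i s)
    have "lookup (fold (rder V) s (p * rder V i a)) [] = 0"
      "lookup (fold (rder V) s (rder V i p * g_act V (yd_deg V i) a)) [] = 0"
      using Cons by (simp_all add: keys_rder keys_g_act nulls_rder)
    then show ?case by (simp add: rder_mult lookup_add)
  qed (simp add: lookup_mult_Nil nulls_Nil)
  then show ?thesis using assms by (simp add: nulls_def keys_mult_words_of)
qed

lemma nulls_restrict_length:
  fixes V :: "('g::ab_group_add, 'k::field) diag_yd"
  shows "p \<in> nulls V \<Longrightarrow> restrict_words (\<lambda>u. length u = m) p \<in> nulls V"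
\<comment> \<open>The shift \<open>k\<close> counts the derivatives already taken, each of which
  shortens words by one.\<close>
proof (rule nulls_coinduct[of _ "{restrict_words (\<lambda>u. length u + k = m) q | k q. q \<in> nulls V}"])
  assume "p \<in> nulls V"
  then show "restrict_words (\<lambda>u. length u = m) p \<in> {restrict_words (\<lambda>u. length u + k = m) q | k q. q \<in> nulls V}"
    by (auto intro!: exI[of _ "0::nat"] exI[of _ p])
next
  fix r assume "r \<in> {restrict_words (\<lambda>u. length u + k = m) q | k q. q \<in> nulls V}"
  then obtain k q where r: "r = restrict_words (\<lambda>u. length u + k = m) q" "q \<in> nulls V" by blast
  have "rder V i r = restrict_words (\<lambda>u. length u + Suc k = m) (rder V i q)" for i
    unfolding r(1) by (rule rder_restrict) (auto dest!: rder_degrees)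
  then have "rder V i r \<in> {restrict_words (\<lambda>u. length u + k = m) q | k q. q \<in> nulls V}" for i
    using nulls_rder[OF r(2), of i] by blast
  then show "keys r \<subseteq> words_of V \<and> lookup r [] = 0 \<and>
      (\<forall>i. rder V i r \<in> {restrict_words (\<lambda>u. length u + k = m) q | k q. q \<in> nulls V})"
    using r nulls_keys[OF r(2)] nulls_Nil[OF r(2)] by (simp add: keys_restrict_words)
qed

lemma nulls_g_component: "p \<in> nulls V \<Longrightarrow> g_component V g p \<in> nulls V"
  unfolding g_component_def
\<comment> \<open>Here \<open>h\<close> is the total degree of the letters already removed by
  derivatives.\<close>
proof (rule nulls_coinduct[of _ "{restrict_words (\<lambda>u. word_deg V u + h = g) q | h q. q \<in> nulls V}"])
  assume "p \<in> nulls V"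
  then show "restrict_words (\<lambda>u. word_deg V u = g) p \<in>
      {restrict_words (\<lambda>u. word_deg V u + h = g) q | h q. q \<in> nulls V}"
    by (auto intro!: exI[of _ 0] exI[of _ p])
next
  fix r assume "r \<in> {restrict_words (\<lambda>u. word_deg V u + h = g) q | h q. q \<in> nulls V}"
  then obtain h q where r: "r = restrict_words (\<lambda>u. word_deg V u + h = g) q" "q \<in> nulls V" by blast
  have "rder V i r = restrict_words (\<lambda>u. word_deg V u + (yd_deg V i + h) = g) (rder V i q)" for i
    unfolding r(1) by (rule rder_restrict) (auto dest!: rder_degrees simp: add_ac)
  then have "rder V i r \<in> {restrict_words (\<lambda>u. word_deg V u + h = g) q | h q. q \<in> nulls V}" for i
    using nulls_rder[OF r(2), of i] by auto
  then show "keys r \<subseteq> words_of V \<and> lookup r [] = 0 \<and>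
      (\<forall>i. rder V i r \<in> {restrict_words (\<lambda>u. word_deg V u + h = g) q | h q. q \<in> nulls V})"
    using r nulls_keys[OF r(2)] nulls_Nil[OF r(2)] by (simp add: keys_restrict_words)
qed

section \<open>The antipode and the radical\<close>

lemma antipode_simps [simp]:
  "antipode V (p + q) = antipode V p + antipode V q"
  "antipode V (scale c p) = scale c (antipode V p)"
  "antipode V 0 = 0" "antipode V (single [] c) = single [] c"
  by (simp_all add: antipode_def one_words)

text \<open>The scalar in \<open>antipode_word\<close> is an eigenvalue of the group action on a
  word, so linear extension turns it into \<open>g_act\<close> on all of \<open>p\<close>.\<close>

lemma antipode_letter:
  "antipode V (single [j] 1 * p) = - (antipode V (g_act V (yd_deg V j) p) * single [j] 1)"
  by (rule lin_eq_on[where S = UNIV and F = "\<lambda>p. antipode V (single [j] 1 * p)"])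
    (auto simp: lin_iff algebra_simps lc.scale_minus_right,
      simp_all add: antipode_def g_act_single single_mult_single lc.scale_minus_right)

lemma g_act_uminus [simp]: "g_act V g (- p) = - g_act V g p"
  by (rule poly_mapping_eqI) simp

lemma antipode_g_act: "antipode V (g_act V g p) = g_act V g (antipode V p)"
proof (rule lin_eq_on[where S = UNIV and F = "\<lambda>p. antipode V (g_act V g p)"])
  fix u
  have eigen: "g_act V h (single v 1) = scale (word_chr V v h) (single v 1)" for h v
    by (simp add: g_act_single)
  have "g_act V g (antipode V (single u 1)) = scale (word_chr V u g) (antipode V (single u 1))"
  proof (induction u)
    case (Cons j u)
    then show ?case unfolding single_Cons[of j u]
      by (simp add: antipode_letter eigen g_act_mult lc.scale_minus_right mult_ac del: scale_single)
  qed (simp add: g_act_single)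
  then show "antipode V (g_act V g (single u 1)) = g_act V g (antipode V (single u 1))"
    by (simp only: eigen antipode_simps)
qed (auto simp: lin_iff)

lemma keys_antipode: "keys p \<subseteq> words_of V \<Longrightarrow> keys (antipode V p) \<subseteq> words_of V"
proof (rule lin_keys[where F = "antipode V"])
  fix u assume "u \<in> words_of V"
  then show "keys (antipode V (single u 1)) \<subseteq> words_of V"
  proof (induction u)
    case (Cons j u)
    then show ?case unfolding single_Cons[of j u] antipode_letter antipode_g_act
      by (simp add: keys_g_act keys_mult_words_of)
  qed simp
qed (simp_all add: lin_iff)

lemma rder_uminus [simp]: "rder V i (- p) = - rder V i p"
  using rder_simps(5)[of V i 0 p] by simp

text \<open>The antipode reverses the coproduct up to braiding, so splitting off a last factor of
  \<open>S(p)\<close> amounts to splitting off a first factor of \<open>p\<close>. The sign is that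
  of \<open>S(x_i) = - x_i\<close>, and the group action comes from the braiding.\<close>

lemma rder_antipode: "rder V i (antipode V p) = - antipode V (g_act V (yd_deg V i) (lder V i p))"
proof (rule lin_eq_on[where S = UNIV and F = "\<lambda>p. rder V i (antipode V p)"])
  fix u
  show "rder V i (antipode V (single u 1)) = - antipode V (g_act V (yd_deg V i) (lder V i (single u 1)))"
  proof (induction u)
    case (Cons j u)
    have letter: "rder V i (single [j] 1) = (if i = j then single [] 1 else 0)"
      using rder_letter[of V i j "single [] 1"] by (simp add: single_mult_single g_act_single)
    have letter_g: "g_act V h (single [j] 1) = scale (yd_chr V j h) (single [j] 1)" for h
      by (simp add: g_act_single)
    show ?case unfolding single_Cons[of j u] lder_letter antipode_letter
      using Cons.IH
      by (auto simp: rder_mult letter letter_g g_act_letter antipode_letter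
          antipode_g_act rder_g_act algebra_simps lc.scale_minus_right
          g_act_commute simp del: scale_single)
  qed simp
qed (auto simp: lin_iff lc.scale_minus_right)

lemma lookup_antipode_Nil: "lookup (antipode V p) [] = lookup p []"
proof (rule functional_eqI[where f = "\<lambda>p. lookup (antipode V p) []" and g = "\<lambda>p. lookup p []"])
  fix u
  show "lookup (antipode V (single u 1)) [] = lookup (single u 1) []"
  proof (cases u)
    case (Cons j v)
    show ?thesis unfolding Cons single_Cons[of j v] antipode_letter
      by (simp add: lookup_mult_Nil) (simp add: lookup_single)
  qed simp
qed (simp_all add: lookup_add)

lemma nulls_antipode: "p \<in> nulls V \<Longrightarrow> antipode V p \<in> nulls V"
proof (rule nulls_coinduct[of _ "antipode V ` nulls V"])
  fix r assume "r \<in> antipode V ` nulls V"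
  then obtain q where q: "q \<in> nulls V" "r = antipode V q" by blast
  have "rder V i r \<in> antipode V ` nulls V" for i
  proof
    show "rder V i r = antipode V (scale (-1) (g_act V (yd_deg V i) (lder V i q)))"
      unfolding q(2) rder_antipode antipode_simps by simp
    show "scale (-1) (g_act V (yd_deg V i) (lder V i q)) \<in> nulls V"
      by (intro nulls_scale nulls_g_act nulls_lder q)
  qed
  then show "keys r \<subseteq> words_of V \<and> lookup r [] = 0 \<and> (\<forall>i. rder V i r \<in> antipode V ` nulls V)"
    using q keys_antipode[OF nulls_keys[OF q(1)]] nulls_Nil[OF q(1)] by (simp add: lookup_antipode_Nil)
qed simp

section \<open>Operations of the tensor algebras, and linear spans\<close>

lemma tensor_algebra_simps [simp]:
  "carrier (tensor_algebra V) = {p. keys p \<subseteq> words_of V}" "mult (tensor_algebra V) = (*)"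
  "one (tensor_algebra V) = 1" "zero (tensor_algebra V) = 0" "add (tensor_algebra V) = (+)"
  "smult (tensor_algebra V) = scale"
  by (simp_all add: tensor_algebra_def)

lemma braided_square_simps [simp]:
  "carrier (braided_square V) = {z. keys z \<subseteq> words_of V \<times> words_of V}"
  "one (braided_square V) = single ([], []) 1" "zero (braided_square V) = 0"
  "add (braided_square V) = (+)" "smult (braided_square V) = scale"
  by (simp_all add: braided_square_def)

lemma span_in_zero: "\<zero>\<^bsub>M\<^esub> \<in> span_in M X"
  by (auto simp: span_in_def is_subspace_def)

lemma span_in_add: "x \<in> span_in M X \<Longrightarrow> y \<in> span_in M X \<Longrightarrow> x \<oplus>\<^bsub>M\<^esub> y \<in> span_in M X"
  by (auto simp: span_in_def is_subspace_def)

lemma span_in_smult: "x \<in> span_in M X \<Longrightarrow> c \<odot>\<^bsub>M\<^esub> x \<in> span_in M X"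
  by (auto simp: span_in_def is_subspace_def)

lemma span_in_superset: "x \<in> X \<Longrightarrow> x \<in> span_in M X"
  by (auto simp: span_in_def)

lemma span_in_minimal: "is_subspace M S \<Longrightarrow> X \<subseteq> S \<Longrightarrow> span_in M X \<subseteq> S"
  by (auto simp: span_in_def)

section \<open>The comultiplication\<close>

text \<open>Left multiplication by the coproduct of a letter, made linear on all pairs of words so
  that identities can be checked on basis elements.\<close>

definition letter_comult ::
  "('g, 'k::field) diag_yd \<Rightarrow> nat \<Rightarrow> ((nat list \<times> nat list) \<Rightarrow>\<^sub>0 'k) \<Rightarrow> ((nat list \<times> nat list) \<Rightarrow>\<^sub>0 'k)" where
  "letter_comult V j = lin_ext (\<lambda>(u, v). single (j # u, v) 1 + single (u, j # v) (word_chr V u (yd_deg V j)))"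

lemma lin_letter_comult: "lin (letter_comult V j)"
  by (simp add: letter_comult_def)

lemmas letter_comult_simps [simp] =
  module_hom.add[OF lin_letter_comult] module_hom.scale[OF lin_letter_comult]
  module_hom.zero[OF lin_letter_comult]

lemma letter_comult_single:
  "letter_comult V j (single (u, v) c) =
     single (j # u, v) c + single (u, j # v) (c * word_chr V u (yd_deg V j))"
  by (simp add: letter_comult_def lc.scale_right_distrib)

lemma braided_mult_letter:
  assumes "is_diag_yd V" "keys z \<subseteq> words_of V \<times> words_of V"
  shows "(single ([j], []) 1 + single ([], [j]) 1) \<otimes>\<^bsub>braided_square V\<^esub> z = letter_comult V j z"
proof -
  let ?x = "single ([j], []) (1::'b) + single ([], [j]) 1"
  have keys: "keys ?x = {([j], []), ([], [j])}"
    by (auto simp: in_keys_iff lookup_add lookup_single when_def split: if_splits)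
  \<comment> \<open>In the summand \<open>x_j \<otimes> 1\<close> the second factor has degree 0,
    and the character at 0 is known to be 1 only for letters of \<open>V\<close>.\<close>
  have chr: "word_chr V (fst x) 0 = 1" if "x \<in> keys z" for x
    using that assms by (metis word_chr_zero mem_Times_iff subsetD)
  show ?thesis unfolding braided_square_def letter_comult_def lin_ext_def
    by (auto simp: keys lookup_add lookup_single when_def case_prod_beta chr lc.scale_right_distrib
        simp flip: sum.distrib intro!: sum.cong)
qed

lemma keys_letter_comult:
  assumes "j < yd_dim V" "keys z \<subseteq> words_of V \<times> words_of V"
  shows "keys (letter_comult V j z) \<subseteq> words_of V \<times> words_of V"
proof (rule lin_keys[OF lin_letter_comult assms(2)])
  fix x assume "x \<in> words_of V \<times> words_of V"
  then show "keys (letter_comult V j (single x 1)) \<subseteq> words_of V \<times> words_of V"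
    using assms(1) by (cases x) (simp add: letter_comult_single keys_add_le)
qed

lemma keys_comult_word:
  assumes "is_diag_yd V" "u \<in> words_of V"
  shows "keys (comult_word V u) \<subseteq> words_of V \<times> words_of V"
  using assms(2)
proof (induction u)
  case (Cons j u)
  then have "keys (letter_comult V j (comult_word V u)) \<subseteq> words_of V \<times> words_of V"
    by (intro keys_letter_comult) auto
  then show ?case using Cons by (simp add: braided_mult_letter[OF assms(1)])
qed simp

lemma comult_simps [simp]:
  "comult V (p + q) = comult V p + comult V q" "comult V (scale c p) = scale c (comult V p)"
  "comult V 0 = 0" "comult V (single [] 1) = single ([], []) 1"
  by (simp_all add: comult_def)

lemma keys_comult:
  assumes "is_diag_yd V" "keys p \<subseteq> words_of V"
  shows "keys (comult V p) \<subseteq> words_of V \<times> words_of V"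
  by (rule lin_keys[OF _ assms(2), where F = "comult V"])
    (simp_all add: comult_def keys_comult_word[OF assms(1)])

lemma comult_letter:
  assumes "is_diag_yd V" "keys p \<subseteq> words_of V" "j < yd_dim V"
  shows "comult V (single [j] 1 * p) = letter_comult V j (comult V p)"
  by (rule lin_eq_on[OF _ _ assms(2), where F = "\<lambda>p. comult V (single [j] 1 * p)"])
    (simp_all add: lin_iff distrib_left comult_def single_mult_single
      braided_mult_letter[OF assms(1) keys_comult_word[OF assms(1)]])

section \<open>Derivations and functionals on the second tensor factor\<close>

definition tensor_word :: "nat list \<Rightarrow> 'k::field words \<Rightarrow> ((nat list \<times> nat list) \<Rightarrow>\<^sub>0 'k)" where
  "tensor_word u = lin_ext (\<lambda>v. single (u, v) 1)"

definition rder_snd ::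
  "('g, 'k::field) diag_yd \<Rightarrow> nat \<Rightarrow> ((nat list \<times> nat list) \<Rightarrow>\<^sub>0 'k) \<Rightarrow> ((nat list \<times> nat list) \<Rightarrow>\<^sub>0 'k)" where
  "rder_snd V i = lin_ext (\<lambda>(u, v). tensor_word u (rder V i (single v 1)))"

definition g_act2 ::
  "('g, 'k::field) diag_yd \<Rightarrow> 'g \<Rightarrow> ((nat list \<times> nat list) \<Rightarrow>\<^sub>0 'k) \<Rightarrow> ((nat list \<times> nat list) \<Rightarrow>\<^sub>0 'k)" where
  "g_act2 V g = lin_ext (\<lambda>(u, v). single (u, v) (word_chr V u g * word_chr V v g))"

text \<open>Slices a tensor: the identity on the first factor and, on the second, the functional of
  \<open>nulls\<close> attached to the index word \<open>t\<close>.\<close>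

definition contract ::
  "('g, 'k::field) diag_yd \<Rightarrow> nat list \<Rightarrow> ((nat list \<times> nat list) \<Rightarrow>\<^sub>0 'k) \<Rightarrow> 'k words" where
  "contract V t = lin_ext (\<lambda>(u, v). single u (lookup (fold (rder V) t (single v 1)) []))"

lemma pair_lin_simps [simp]:
  "tensor_word u (p + q) = tensor_word u p + tensor_word u q"
  "tensor_word u (scale c p) = scale c (tensor_word u p)"
  "tensor_word u 0 = 0" "tensor_word u (single v c) = single (u, v) c"
  "rder_snd V i (y + z) = rder_snd V i y + rder_snd V i z"
  "rder_snd V i (scale c z) = scale c (rder_snd V i z)" "rder_snd V i 0 = 0"
  "g_act2 V g (y + z) = g_act2 V g y + g_act2 V g z"
  "g_act2 V g (scale c z) = scale c (g_act2 V g z)" "g_act2 V g 0 = 0"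
  "contract V t (y + z) = contract V t y + contract V t z"
  "contract V t (scale c z) = scale c (contract V t z)" "contract V t 0 = 0"
  by (simp_all add: tensor_word_def rder_snd_def g_act2_def contract_def)

lemma rder_snd_single: "rder_snd V i (single (u, v) c) = scale c (tensor_word u (rder V i (single v 1)))"
  by (simp add: rder_snd_def)

lemma g_act2_single: "g_act2 V g (single (u, v) c) = single (u, v) (c * (word_chr V u g * word_chr V v g))"
  by (simp add: g_act2_def)

lemma contract_single: "contract V t (single (u, v) c) = single u (c * lookup (fold (rder V) t (single v 1)) [])"
  by (simp add: contract_def)

lemma contract_tensor_word:
  "contract V t (tensor_word u q) = scale (lookup (fold (rder V) t q) []) (single u 1)"
  by (rule lin_eq_on[where S = UNIV and F = "\<lambda>q. contract V t (tensor_word u q)"])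
    (auto simp: lin_iff lookup_add contract_single lc.scale_left_distrib single_add)

lemma letter_comult_tensor_word:
  "letter_comult V j (tensor_word u q) =
     tensor_word (j # u) q + scale (word_chr V u (yd_deg V j)) (tensor_word u (single [j] 1 * q))"
  by (rule lin_eq_on[where S = UNIV and F = "\<lambda>q. letter_comult V j (tensor_word u q)"])
    (auto simp: lin_iff letter_comult_single single_mult_single lc.scale_right_distrib distrib_left
      algebra_simps)

text \<open>The extra term arises when the letter sits in the second factor: its braiding past the
  first factor and the twist in \<open>rder_letter\<close> combine to the diagonal group
  action.\<close>

lemma rder_snd_letter_comult:
  "rder_snd V i (letter_comult V j z) =
     letter_comult V j (rder_snd V i z) + (if i = j then g_act2 V (yd_deg V i) z else 0)"
proof (rule lin_eq_on[where S = UNIV and F = "\<lambda>z. rder_snd V i (letter_comult V j z)"])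
  fix x :: "nat list \<times> nat list"
  obtain u v where x: "x = (u, v)" by fastforce
  show "rder_snd V i (letter_comult V j (single x 1)) =
      letter_comult V j (rder_snd V i (single x 1)) + (if i = j then g_act2 V (yd_deg V i) (single x 1) else 0)"
    unfolding x letter_comult_single
    by (auto simp: rder_snd_single letter_comult_tensor_word g_act2_single single_Cons[of j v] rder_letter
        g_act_single lc.scale_right_distrib algebra_simps simp del: scale_single) (simp add: mult_ac)
qed (auto simp: lin_iff lc.scale_right_distrib)

lemma g_act2_letter_comult:
  "g_act2 V g (letter_comult V j z) = scale (yd_chr V j g) (letter_comult V j (g_act2 V g z))"
  by (rule lin_eq_on[where S = UNIV and F = "\<lambda>z. g_act2 V g (letter_comult V j z)"])
    (auto simp: lin_iff letter_comult_single g_act2_single lc.scale_right_distrib mult_ac)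

lemma comult_g_act:
  assumes "is_diag_yd V" "keys p \<subseteq> words_of V"
  shows "comult V (g_act V g p) = g_act2 V g (comult V p)"
proof (rule lin_eq_on[OF _ _ assms(2), where F = "\<lambda>p. comult V (g_act V g p)"])
  fix u assume "u \<in> words_of V"
  then show "comult V (g_act V g (single u 1)) = g_act2 V g (comult V (single u 1))"
  proof (induction u)
    case (Cons j u)
    then show ?case unfolding single_Cons[of j u] g_act_letter
      by (simp add: comult_letter[OF assms(1)] keys_g_act g_act2_letter_comult)
  qed (simp add: g_act_single g_act2_single)
qed (auto simp: lin_iff)

text \<open>Coassociativity expressed by derivations; both sides obey the same recursion on the
  first letter.\<close>

lemma rder_snd_comult:
  assumes "is_diag_yd V" "keys p \<subseteq> words_of V"
  shows "rder_snd V i (comult V p) = comult V (rder V i p)"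
proof (rule lin_eq_on[OF _ _ assms(2), where F = "\<lambda>p. rder_snd V i (comult V p)"])
  fix u assume "u \<in> words_of V"
  then show "rder_snd V i (comult V (single u 1)) = comult V (rder V i (single u 1))"
  proof (induction u)
    case (Cons j u)
    then show ?case unfolding single_Cons[of j u] rder_letter
      by (auto simp: comult_letter[OF assms(1)] keys_rder rder_snd_letter_comult comult_g_act[OF assms(1)])
  qed (simp add: rder_snd_single)
qed (auto simp: lin_iff)

lemma contract_Nil_letter_comult:
  "contract V [] (letter_comult V j z) = single [j] 1 * contract V [] z"
  by (rule lin_eq_on[where S = UNIV and F = "\<lambda>z. contract V [] (letter_comult V j z)"])
    (auto simp: lin_iff letter_comult_single contract_single distrib_left single_mult_single lookup_single)

lemma contract_Cons: "contract V (i # t) z = contract V t (rder_snd V i z)"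
  by (rule lin_eq_on[where S = UNIV and F = "contract V (i # t)"])
    (auto simp: lin_iff contract_single rder_snd_single contract_tensor_word)

text \<open>For the empty index word this is the counit axiom, and each further index passes through
  the coproduct by \<open>rder_snd_comult\<close>. The case \<open>t = [i]\<close> identifies
  \<open>rder\<close> as a slice of the coproduct.\<close>

lemma contract_comult:
  assumes "is_diag_yd V" "keys p \<subseteq> words_of V"
  shows "contract V t (comult V p) = fold (rder V) t p"
  using assms(2)
proof (induction t arbitrary: p)
  case Nil
  show ?case
  proof (rule lin_eq_on[OF _ _ Nil, where F = "\<lambda>p. contract V [] (comult V p)"])
    fix u assume "u \<in> words_of V"
    then show "contract V [] (comult V (single u 1)) = fold (rder V) [] (single u 1)"
    proof (induction u)
      case (Cons j u)
      then show ?case unfolding single_Cons[of j u]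
        by (simp add: comult_letter[OF assms(1)] contract_Nil_letter_comult)
    qed (simp add: contract_single lookup_single)
  qed (auto simp: lin_iff)
next
  case (Cons i t)
  then show ?case by (simp add: contract_Cons rder_snd_comult[OF assms(1)] keys_rder)
qed

section \<open>Elementary tensors and the coideal property of the radical\<close>

lemma lookup_tensor_of [simp]: "lookup (tensor_of p q) (u, v) = lookup p u * lookup q v"
proof -
  have delta: "(\<Sum>x\<in>keys r. lookup r x when x = y) = lookup r y" for r :: "nat list \<Rightarrow>\<^sub>0 'a" and y
    by (simp add: when_def in_keys_iff)
  have "lookup (tensor_of p q) (u, v) =
      (\<Sum>x\<in>keys p. \<Sum>y\<in>keys q. (lookup p x when x = u) * (lookup q y when y = v))"
    unfolding tensor_of_def lookup_sum
    by (intro sum.cong refl) (auto simp: lookup_single when_def)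
  then show ?thesis by (simp add: delta flip: sum_product)
qed

lemma tensor_of_simps:
  "tensor_of (p + p') q = tensor_of p q + tensor_of p' q"
  "tensor_of p (q + q') = tensor_of p q + tensor_of p q'"
  "tensor_of (p - p') q = tensor_of p q - tensor_of p' q"
  "tensor_of (scale c p) q = scale c (tensor_of p q)"
  "tensor_of p (scale c q) = scale c (tensor_of p q)"
  by (rule poly_mapping_eqI, auto simp: lookup_add lookup_minus algebra_simps)+

lemma tensor_of_sum: "tensor_of p (\<Sum>i\<in>I. f i) = (\<Sum>i\<in>I. tensor_of p (f i))"
  by (rule poly_mapping_eqI) (auto simp: lookup_sum sum_distrib_left)

lemma tensor_of_single: "tensor_of (single u a) (single v b) = single (u, v) (a * b)"
  by (rule poly_mapping_eqI) (auto simp: lookup_single when_def split: if_splits)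

lemma keys_tensor_of: "keys p \<subseteq> S \<Longrightarrow> keys q \<subseteq> S' \<Longrightarrow> keys (tensor_of p q) \<subseteq> S \<times> S'"
  by (auto simp: in_keys_iff)

lemma lin_fold_rder: "lin (fold (rder V) t)"
  by (simp add: lin_iff)

lemma contract_tensor_of:
  "contract V t (tensor_of p q) = scale (lookup (fold (rder V) t q) []) p"
proof (rule bilin_eqI[where F = "\<lambda>p q. contract V t (tensor_of p q)"
      and G = "\<lambda>p q. scale (lookup (fold (rder V) t q) []) p"])
qed (auto simp: lin_iff tensor_of_simps tensor_of_single contract_single lookup_add
    lc.scale_left_distrib lc.scale_right_distrib mult_ac)

text \<open>
  The radical is the common kernel of functionals, and a tensor killed by all products of two such
  functionals lies in \<open>nulls \<otimes> T + T \<otimes> nulls\<close>: if some functional does not vanish on the left factor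
  of the last summand, its right factor can be eliminated modulo the radical.
\<close>

lemma tensor_separation:
  fixes n :: nat
  assumes U_add: "\<And>y z. y \<in> U \<Longrightarrow> z \<in> U \<Longrightarrow> y + z \<in> U" and U_zero: "0 \<in> U"
    and left: "\<And>p q. p \<in> nulls V \<Longrightarrow> keys q \<subseteq> words_of V \<Longrightarrow> tensor_of p q \<in> U"
    and right: "\<And>p q. keys p \<subseteq> words_of V \<Longrightarrow> q \<in> nulls V \<Longrightarrow> tensor_of p q \<in> U"
    and words: "\<And>i. i < n \<Longrightarrow> keys (a i) \<subseteq> words_of V \<and> keys (b i) \<subseteq> words_of V"
    and null: "\<And>s t. (\<Sum>i<n. lookup (fold (rder V) s (a i)) [] * lookup (fold (rder V) t (b i)) []) = 0"
  shows "(\<Sum>i<n. tensor_of (a i) (b i)) \<in> U"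
  using words null
proof (induction n arbitrary: a)
  case 0
  show ?case using U_zero by simp
next
  case (Suc n)
  define f where "f s p = lookup (fold (rder V) s p) []" for s p
  have f_lin: "f s (p - q) = f s p - f s q" "f s (scale c p) = c * f s p" "f s (p + q) = f s p + f s q"
    "f s (sum h I) = (\<Sum>i\<in>I. f s (h i))" for s p q c h and I :: "nat set"
    using module_hom.diff[OF lin_fold_rder, of V s p q] module_hom.sum[OF lin_fold_rder, of V s h I]
    by (simp_all add: f_def lookup_add lookup_minus lookup_sum)
  have null: "(\<Sum>i<n. f s (a i) * f t (b i)) = - (f s (a n) * f t (b n))" for s t
    using Suc.prems(2)[of s t] by (simp add: f_def add_eq_0_iff2)
  have words: "keys (a i) \<subseteq> words_of V" "keys (b i) \<subseteq> words_of V" if "i \<le> n" for i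
    using Suc.prems(1) that by auto
  show ?case
  proof (cases "\<forall>s. f s (a n) = 0")
    case True
    then have "a n \<in> nulls V" using words[of n] by (simp add: nulls_def f_def)
    moreover have "(\<Sum>i<n. tensor_of (a i) (b i)) \<in> U"
      using null words True by (intro Suc.IH) (simp_all add: f_def)
    ultimately show ?thesis using U_add left words by simp
  next
    case False
    then obtain s0 where c: "f s0 (a n) \<noteq> 0" by blast
    \<comment> \<open>At \<open>s = s0\<close> the hypothesis can be solved for the value of every
      functional on \<open>b n\<close>, with these coefficients; so every functional vanishes on
      \<open>e\<close>.\<close>
    define r where "r i = f s0 (a i) / f s0 (a n)" for i
    define e where "e = b n + (\<Sum>i<n. scale (r i) (b i))"
    have e_f: "f t e = 0" for t
    proof -
      have "f s0 (a n) * f t e = f s0 (a n) * f t (b n) + (\<Sum>i<n. f s0 (a i) * f t (b i))"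
        using c by (simp add: e_def f_lin distrib_left sum_distrib_left r_def)
      then show ?thesis using null[of s0 t] c by simp
    qed
    have "keys e \<subseteq> words_of V"
      unfolding e_def
      using lc.subspace_sum[OF subspace_keys[of "words_of V"], of "{..<n}" "\<lambda>i. scale (r i) (b i)"] words
      by (intro keys_add_le) (auto simp: keys_scale_le)
    then have e: "e \<in> nulls V" using e_f by (simp add: nulls_def f_def)
    have "(\<Sum>i<n. tensor_of (a i - scale (r i) (a n)) (b i)) \<in> U"
    proof (rule Suc.IH)
      show "keys (a i - scale (r i) (a n)) \<subseteq> words_of V \<and> keys (b i) \<subseteq> words_of V" if "i < n" for i
        using words that by (simp add: keys_diff_le keys_scale_le)
      fix s t
      have "(\<Sum>i<n. f s (a i - scale (r i) (a n)) * f t (b i)) =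
          (\<Sum>i<n. f s (a i) * f t (b i)) - f s (a n) * (\<Sum>i<n. r i * f t (b i))"
        by (simp add: f_lin algebra_simps sum_subtractf sum_distrib_left)
      also have "\<dots> = - (f s (a n) * f t e)"
        by (simp add: null e_def f_lin algebra_simps)
      finally show "(\<Sum>i<n. lookup (fold (rder V) s (a i - scale (r i) (a n))) [] *
          lookup (fold (rder V) t (b i)) []) = 0"
        using e_f by (simp add: f_def)
    qed
    moreover have "tensor_of (a n) e \<in> U" using right[OF words(1) e] by simp
    moreover have "(\<Sum>i<Suc n. tensor_of (a i) (b i)) =
        (\<Sum>i<n. tensor_of (a i - scale (r i) (a n)) (b i)) + tensor_of (a n) e"
      by (simp add: e_def tensor_of_simps tensor_of_sum sum_subtractf)
    ultimately show ?thesis using U_add by simp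
  qed
qed

text \<open>Applying the functionals of \<open>s\<close> and \<open>t\<close> to the two factors of
  the coproduct gives, by \<open>contract_comult\<close>, the constant term of an iterated
  derivative of \<open>p\<close>, which vanishes. Thus \<open>tensor_separation\<close>
  applies.\<close>

lemma nulls_comult:
  assumes V: "is_diag_yd V" and p: "p \<in> nulls V"
  shows "comult V p \<in> span_in (braided_square V)
        ({tensor_of a b | a b. a \<in> nulls V \<and> b \<in> carrier (tensor_algebra V)} \<union>
         {tensor_of a b | a b. a \<in> carrier (tensor_algebra V) \<and> b \<in> nulls V})"
    (is "_ \<in> span_in ?M ?X")
proof -
  let ?z = "comult V p"
  \<comment> \<open>Enumerating the support writes the coproduct as a numbered sum of elementary
    tensors, with the coefficients put into the left factors.\<close>
  obtain h where h: "bij_betw h {..<card (keys ?z)} (keys ?z)"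
    using ex_bij_betw_nat_finite[OF finite_keys] by (metis atLeast0LessThan)
  define n where "n = card (keys ?z)"
  define a where "a i = single (fst (h i)) (lookup ?z (h i))" for i
  define b where "b i = single (snd (h i)) (1::'b)" for i
  have "?z = (\<Sum>x\<in>keys ?z. scale (lookup ?z x) (single x 1))" by (rule sum_scale_single)
  also have "\<dots> = (\<Sum>i<n. scale (lookup ?z (h i)) (single (h i) 1))"
    unfolding n_def by (rule sum.reindex_bij_betw[OF h, symmetric])
  finally have z: "?z = (\<Sum>i<n. tensor_of (a i) (b i))"
    by (simp add: a_def b_def tensor_of_single)
  have words: "keys (a i) \<subseteq> words_of V \<and> keys (b i) \<subseteq> words_of V" if "i < n" for i
  proof -
    have "h i \<in> keys ?z" using bij_betwE[OF h] that by (auto simp: n_def)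
    then show ?thesis using keys_comult[OF V nulls_keys[OF p]] by (auto simp: a_def b_def)
  qed
  have "(\<Sum>i<n. tensor_of (a i) (b i)) \<in> span_in ?M ?X"
  proof (rule tensor_separation[OF _ _ _ _ words])
    fix s t
    have "contract V t ?z = (\<Sum>i<n. scale (lookup (fold (rder V) t (b i)) []) (a i))"
      unfolding z using module_hom.sum[of scale scale "contract V t" "\<lambda>i. tensor_of (a i) (b i)" "{..<n}"]
      by (simp add: contract_tensor_of lin_iff)
    then have "fold (rder V) t p = (\<Sum>i<n. scale (lookup (fold (rder V) t (b i)) []) (a i))"
      using contract_comult[OF V nulls_keys[OF p]] by simp
    then have "fold (rder V) s (fold (rder V) t p) =
        (\<Sum>i<n. scale (lookup (fold (rder V) t (b i)) []) (fold (rder V) s (a i)))"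
      by (simp add: module_hom.sum[OF lin_fold_rder])
    moreover have "lookup (fold (rder V) s (fold (rder V) t p)) [] = 0"
      by (rule nulls_Nil[OF nulls_fold_rder[OF nulls_fold_rder[OF p]]])
    ultimately show "(\<Sum>i<n. lookup (fold (rder V) s (a i)) [] * lookup (fold (rder V) t (b i)) []) = 0"
      by (simp add: lookup_sum mult.commute)
  next
    show "0 \<in> span_in ?M ?X" using span_in_zero[of ?M ?X] by simp
  next
    fix y y' assume "y \<in> span_in ?M ?X" "y' \<in> span_in ?M ?X"
    then show "y + y' \<in> span_in ?M ?X" using span_in_add[of y ?M ?X y'] by simp
  qed (auto intro!: span_in_superset)
  then show ?thesis using z by simp
qed

section \<open>The Nichols ideal\<close>

lemma ring_tensor_algebra: "ring (tensor_algebra V)"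
proof (rule ringI)
  show "abelian_group (tensor_algebra V)"
  proof (rule abelian_groupI)
    fix x assume "x \<in> carrier (tensor_algebra V)"
    then show "\<exists>y\<in>carrier (tensor_algebra V). y \<oplus>\<^bsub>tensor_algebra V\<^esub> x = \<zero>\<^bsub>tensor_algebra V\<^esub>"
      by (intro bexI[of _ "- x"]) auto
  qed (auto simp: add_ac intro: keys_add_le[THEN subsetD])
  show "monoid (tensor_algebra V)"
    by (rule monoidI) (auto simp: mult.assoc one_words intro: keys_mult_words_of[THEN subsetD])
qed (simp_all add: algebra_simps)

lemma ideal_nulls: "ideal (nulls V) (tensor_algebra V)"
proof (rule idealI)
  interpret ring "tensor_algebra V" by (rule ring_tensor_algebra)
  show "subgroup (nulls V) (add_monoid (tensor_algebra V))"
  proof (rule add.subgroupI)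
    fix a assume "a \<in> nulls V"
    moreover from this have "\<ominus>\<^bsub>tensor_algebra V\<^esub> a = - a"
      using nulls_keys[of a V] by (intro minus_equality) auto
    ultimately show "\<ominus>\<^bsub>tensor_algebra V\<^esub> a \<in> nulls V" by (simp add: nulls_neg)
  qed (use nulls_keys[of _ V] nulls_zero[of V] nulls_add[of _ V] in auto)
qed (simp_all add: ring_tensor_algebra nulls_mult_left nulls_mult_right)

lemma ideal_add:
  assumes "ideal I (tensor_algebra V)" "p \<in> I" "q \<in> I"
  shows "p + q \<in> I"
  using additive_subgroup.a_closed[OF ideal.axioms(1)[OF assms(1)] assms(2,3)] by simp

lemma ideal_zero: "ideal I (tensor_algebra V) \<Longrightarrow> 0 \<in> I"
  using additive_subgroup.zero_closed[OF ideal.axioms(1)] by fastforce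

text \<open>Ring ideals are closed under scalars here because \<open>single [] c\<close> is an
  element of the tensor algebra.\<close>

lemma ideal_scale:
  assumes "ideal I (tensor_algebra V)" "p \<in> I"
  shows "scale c p \<in> I"
proof -
  have "single [] c * p \<in> I"
    using ideal.I_l_closed[OF assms, of "single [] c"] by auto
  moreover have "single [] c * p = scale c (single [] 1 * p)"
    unfolding mult_scale_left[symmetric] by simp
  ultimately show ?thesis by simp
qed

lemma nulls_graded_hopf_ideal: "is_diag_yd V \<Longrightarrow> is_graded_hopf_ideal V (nulls V)"
  unfolding is_graded_hopf_ideal_def
  by (intro conjI ballI allI ideal_nulls nulls_restrict_length nulls_g_act nulls_g_component
      nulls_comult nulls_Nil nulls_antipode)

text \<open>The radical is graded, hence the sum of its homogeneous parts; those of degree 0 and 1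
  vanish because the constant terms of its elements and of their derivatives do.\<close>

lemma nulls_generated: "generated_in_degrees_ge2 V (nulls V)"
  for V :: "('g::ab_group_add, 'k::field) diag_yd"
proof -
  let ?S = "{p \<in> nulls V. \<exists>m\<ge>2. \<forall>u\<in>keys p. length u = m}"
  have "nulls V \<subseteq> I" if I: "ideal I (tensor_algebra V)" "?S \<subseteq> I" for I
  proof
    fix p assume p: "p \<in> nulls V"
    let ?r = "\<lambda>m. restrict_words (\<lambda>u. length u = m) p"
    have r: "?r m \<in> I" for m
    proof (cases "m \<ge> 2")
      case True
      then have "?r m \<in> ?S" using nulls_restrict_length[OF p, of m]
        by (auto simp: in_keys_iff split: if_splits)
      then show ?thesis using I(2) by blast
    next
      case False
      have "lookup p [i] = 0" for i
        using nulls_Nil[OF nulls_rder[OF p, of i]] by (simp add: lookup_rder_Nil)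
      then have "lookup p u = 0" if "length u = m" for u
        using False that nulls_Nil[OF p] by (cases u; cases "tl u") auto
      then have "?r m = 0" by (intro poly_mapping_eqI) auto
      then show ?thesis using ideal_zero[OF I(1)] by simp
    qed
    have "p = (\<Sum>m\<in>length ` keys p. ?r m)"
    proof (rule poly_mapping_eqI)
      fix u
      show "lookup p u = lookup (\<Sum>m\<in>length ` keys p. ?r m) u"
        by (auto simp: lookup_sum in_keys_iff)
    qed
    moreover have "(\<Sum>m\<in>M. ?r m) \<in> I" if "finite M" for M
      using that by (induction M) (auto simp: ideal_zero[OF I(1)] ideal_add[OF I(1)] r)
    ultimately show "p \<in> I" by (metis finite_imageI finite_keys)
  qed
  moreover have "?S \<subseteq> nulls V" by auto
  ultimately have "nulls V = Idl\<^bsub>tensor_algebra V\<^esub> ?S"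
    unfolding genideal_def using ideal_nulls by auto
  then show ?thesis unfolding generated_in_degrees_ge2_def using nulls_keys by (intro exI[of _ ?S]) auto
qed

lemma lookup_mult_letter:
  "lookup (p * q) [i] = lookup p [] * lookup q [i] + lookup p [i] * lookup q []" for p q :: "'k::field words"
proof -
  \<comment> \<open>Linear coefficients are constant terms of derivatives for any braiding, so the
    trivial one is taken and the Leibniz rule applied.\<close>
  define V :: "(unit, 'k) diag_yd" where "V = \<lparr>yd_dim = 0, yd_deg = \<lambda>_. (), yd_chr = \<lambda>_ _. 1\<rparr>"
  show ?thesis using lookup_rder_Nil[of V i "p * q"]
    by (simp add: rder_mult lookup_add lookup_mult_Nil lookup_rder_Nil)
qed

text \<open>By \<open>lookup_mult_letter\<close> a product has no linear part once one factor has
  neither constant nor linear part. This ideal contains everything generated in degrees at least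
  2.\<close>

lemma ideal_no_linear_part:
  fixes V :: "('g, 'k::field) diag_yd"
  shows "ideal {p \<in> carrier (tensor_algebra V). lookup p [] = 0 \<and> (\<forall>i. lookup p [i] = 0)} (tensor_algebra V)"
    (is "ideal ?K _")
proof (rule idealI)
  interpret ring "tensor_algebra V" by (rule ring_tensor_algebra)
  show "subgroup ?K (add_monoid (tensor_algebra V))"
  proof (rule add.subgroupI)
    fix a assume "a \<in> ?K"
    moreover from this have "\<ominus>\<^bsub>tensor_algebra V\<^esub> a = - a"
      by (intro minus_equality) auto
    ultimately show "\<ominus>\<^bsub>tensor_algebra V\<^esub> a \<in> ?K" by simp
  qed (auto simp: lookup_add intro: keys_add_le[THEN subsetD] exI[of _ 0])
qed (auto simp: ring_tensor_algebra lookup_mult_Nil lookup_mult_letter keys_mult_words_of[THEN subsetD]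
    intro!: keys_mult_words_of)

text \<open>Slicing the second factor with the linear functional of \<open>x_i\<close> maps
  \<open>I \<otimes> T\<close> into \<open>I\<close> and kills \<open>T \<otimes> I\<close>, because
  elements of \<open>I\<close> have no linear part. The coideal property therefore makes
  \<open>I\<close> stable under all derivations.\<close>

lemma graded_hopf_ideal_subset_nulls:
  assumes V: "is_diag_yd V" and I: "is_graded_hopf_ideal V I" "generated_in_degrees_ge2 V I"
  shows "I \<subseteq> nulls V"
proof
  have ideal: "ideal I (tensor_algebra V)" and Nil: "\<And>p. p \<in> I \<Longrightarrow> lookup p [] = 0"
    and comult: "\<And>p. p \<in> I \<Longrightarrow> comult V p \<in> span_in (braided_square V)
        ({tensor_of a b | a b. a \<in> I \<and> b \<in> carrier (tensor_algebra V)} \<union>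
         {tensor_of a b | a b. a \<in> carrier (tensor_algebra V) \<and> b \<in> I})"
    using I(1) unfolding is_graded_hopf_ideal_def by blast+
  have words: "keys p \<subseteq> words_of V" if "p \<in> I" for p
    using additive_subgroup.a_subset[OF ideal.axioms(1)[OF ideal]] that by auto
  let ?K = "{p \<in> carrier (tensor_algebra V). lookup p [] = 0 \<and> (\<forall>i. lookup p [i] = 0)}"
  obtain S where S: "S \<subseteq> {p \<in> carrier (tensor_algebra V). \<exists>m\<ge>2. \<forall>u\<in>keys p. length u = m}"
    and gen: "I = Idl\<^bsub>tensor_algebra V\<^esub> S"
    using I(2) unfolding generated_in_degrees_ge2_def by blast
  have "S \<subseteq> ?K"
  proof
    fix p assume "p \<in> S"
    then obtain m where "m \<ge> 2" "\<forall>u\<in>keys p. length u = m" "p \<in> carrier (tensor_algebra V)"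
      using S by blast
    then have "[] \<notin> keys p" "[i] \<notin> keys p" for i by fastforce+
    then show "p \<in> ?K" using \<open>p \<in> carrier _\<close> by (auto simp: in_keys_iff)
  qed
  then have "I \<subseteq> ?K" unfolding gen genideal_def using ideal_no_linear_part[of V] by blast
  then have linear: "lookup p [i] = 0" if "p \<in> I" for p i using that by blast
  have rder: "rder V i p \<in> I" if "p \<in> I" for p i
  proof -
    let ?M = "braided_square V" and ?S = "{z \<in> carrier (braided_square V). contract V [i] z \<in> I}"
    let ?X = "{tensor_of a b | a b. a \<in> I \<and> b \<in> carrier (tensor_algebra V)} \<union>
         {tensor_of a b | a b. a \<in> carrier (tensor_algebra V) \<and> b \<in> I}"
    have subspace: "is_subspace ?M ?S"
      unfolding is_subspace_def
      by (simp add: ideal_zero[OF ideal] ideal_add[OF ideal] ideal_scale[OF ideal] keys_add_le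
          keys_scale_le) blast
    have left: "tensor_of a b \<in> ?S" if "a \<in> I" "keys b \<subseteq> words_of V" for a b
      using that keys_tensor_of[OF words that(2)]
      by (simp add: contract_tensor_of ideal_scale[OF ideal])
    have right: "tensor_of a b \<in> ?S" if "keys a \<subseteq> words_of V" "b \<in> I" for a b
      using that keys_tensor_of[OF that(1) words]
      by (simp add: contract_tensor_of lookup_rder_Nil linear ideal_zero[OF ideal])
    have "?X \<subseteq> ?S"
    proof (intro Un_least subsetI)
      fix x assume "x \<in> {tensor_of a b | a b. a \<in> I \<and> b \<in> carrier (tensor_algebra V)}"
      then obtain a b where "x = tensor_of a b" "a \<in> I" "keys b \<subseteq> words_of V" by auto
      then show "x \<in> ?S" using left by blast
    next
      fix x assume "x \<in> {tensor_of a b | a b. a \<in> carrier (tensor_algebra V) \<and> b \<in> I}"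
      then obtain a b where "x = tensor_of a b" "keys a \<subseteq> words_of V" "b \<in> I" by auto
      then show "x \<in> ?S" using right by blast
    qed
    then have "span_in ?M ?X \<subseteq> ?S"
      by (rule span_in_minimal[OF subspace])
    then have "comult V p \<in> ?S" using comult[OF that] by blast
    then show ?thesis using contract_comult[OF V words[OF that], of "[i]"] by simp
  qed
  fix p assume "p \<in> I"
  then show "p \<in> nulls V"
    by (rule nulls_coinduct) (use words Nil rder in auto)
qed

text \<open>The radical is a candidate and bounds all candidates, so \<open>GREATEST\<close> is
  attained. From here on the Nichols algebra is computed with derivations.\<close>

theorem nichols_ideal_eq_nulls: "is_diag_yd V \<Longrightarrow> nichols_ideal V = nulls V"
  unfolding nichols_ideal_def
  by (rule Greatest_equality)
    (use nulls_graded_hopf_ideal nulls_generated graded_hopf_ideal_subset_nulls in blast)+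

section \<open>The Nichols algebra as a quotient\<close>

lemma formal_pairs_simps [simp]:
  "carrier (formal_pairs M N) = {z. keys z \<subseteq> carrier M \<times> carrier N}"
  "zero (formal_pairs M N) = 0" "add (formal_pairs M N) = (+)" "smult (formal_pairs M N) = scale"
  by (simp_all add: formal_pairs_def)

lemma is_diag_yd_dual: "is_diag_yd V \<Longrightarrow> is_diag_yd (dual_yd V)"
  by (simp add: is_diag_yd_def dual_yd_def)

lemma nichols_zero_closed:
  assumes "is_diag_yd V"
  shows "\<zero>\<^bsub>nichols_algebra V\<^esub> \<in> carrier (nichols_algebra V)"
proof -
  interpret ring "tensor_algebra V Quot nulls V" by (rule ideal.quotient_is_ring[OF ideal_nulls])
  show ?thesis
    using zero_closed by (simp add: nichols_algebra_def quotient_algebra_def nichols_ideal_eq_nulls[OF assms])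
qed

lemma boson_of_closed:
  assumes "is_diag_yd V" "f \<in> carrier (nichols_algebra (dual_yd V))"
  shows "boson_of V f \<in> carrier (dual_boson V)"
  using assms(2) nichols_zero_closed[OF is_diag_yd_dual[OF assms(1)]]
  by (auto simp: boson_of_def smash_el_def dual_boson_def smash_product_def)

context
  fixes V :: "('g::ab_group_add, 'k::field) diag_yd"
  assumes V: "is_diag_yd V"
begin

lemma nichols_class_eq_image: "nichols_class V p = (\<lambda>h. h + p) ` nulls V"
  by (simp add: nichols_class_def nichols_ideal_eq_nulls[OF V] a_r_coset_def' UNION_singleton_eq_range)

lemma mem_nichols_class_iff: "q \<in> nichols_class V p \<longleftrightarrow> q - p \<in> nulls V"
proof
  assume "q - p \<in> nulls V"
  then show "q \<in> nichols_class V p"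
    unfolding nichols_class_eq_image by (intro image_eqI[of _ _ "q - p"]) simp_all
qed (auto simp: nichols_class_eq_image)

lemma nichols_class_eq_iff: "nichols_class V p = nichols_class V q \<longleftrightarrow> p - q \<in> nulls V"
proof
  assume "nichols_class V p = nichols_class V q"
  moreover have "p \<in> nichols_class V p" by (simp add: mem_nichols_class_iff nulls_zero)
  ultimately show "p - q \<in> nulls V" by (simp flip: mem_nichols_class_iff)
next
  assume pq: "p - q \<in> nulls V"
  show "nichols_class V p = nichols_class V q"
  proof (rule Set.set_eqI)
    fix r
    have "r - q = (r - p) + (p - q)" "r - p = (r - q) - (p - q)" by simp_all
    then show "r \<in> nichols_class V p \<longleftrightarrow> r \<in> nichols_class V q"
      unfolding mem_nichols_class_iff using nulls_add nulls_diff pq by metis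
  qed
qed

lemma carrier_nichols: "carrier (nichols_algebra V) = nichols_class V ` {p. keys p \<subseteq> words_of V}"
  by (auto simp: nichols_algebra_def quotient_algebra_def FactRing_def A_RCOSETS_def' nichols_class_def)

lemma nichols_class_closed: "keys p \<subseteq> words_of V \<Longrightarrow> nichols_class V p \<in> carrier (nichols_algebra V)"
  by (simp add: carrier_nichols)

lemma nichols_class_hom:
  "(+>\<^bsub>tensor_algebra V\<^esub>) (nulls V) \<in> ring_hom (tensor_algebra V) (tensor_algebra V Quot nulls V)"
  by (rule ideal.rcos_ring_hom[OF ideal_nulls])

lemma nichols_class_add:
  assumes "keys p \<subseteq> words_of V" "keys q \<subseteq> words_of V"
  shows "nichols_class V p \<oplus>\<^bsub>nichols_algebra V\<^esub> nichols_class V q = nichols_class V (p + q)"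
  using ring_hom_add[OF nichols_class_hom, of p q] assms
  by (simp add: nichols_algebra_def quotient_algebra_def nichols_class_def nichols_ideal_eq_nulls[OF V])

lemma nichols_class_mult:
  assumes "keys p \<subseteq> words_of V" "keys q \<subseteq> words_of V"
  shows "nichols_class V p \<otimes>\<^bsub>nichols_algebra V\<^esub> nichols_class V q = nichols_class V (p * q)"
  using ring_hom_mult[OF nichols_class_hom, of p q] assms
  by (simp add: nichols_algebra_def quotient_algebra_def nichols_class_def nichols_ideal_eq_nulls[OF V])

lemma nichols_one: "\<one>\<^bsub>nichols_algebra V\<^esub> = nichols_class V 1"
  using ring_hom_one[OF nichols_class_hom]
  by (simp add: nichols_algebra_def quotient_algebra_def nichols_class_def nichols_ideal_eq_nulls[OF V])

lemma nichols_zero: "\<zero>\<^bsub>nichols_algebra V\<^esub> = nichols_class V 0"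
  by (simp add: nichols_class_eq_image)
    (simp add: nichols_algebra_def quotient_algebra_def FactRing_def nichols_ideal_eq_nulls[OF V])

text \<open>All members of a coset have images in one coset, so the union in
  \<open>induced_map\<close> collapses to it.\<close>

lemma induced_map_nichols_class:
  assumes "lin f" "\<And>h. h \<in> nulls V \<Longrightarrow> f h \<in> nulls V"
  shows "induced_map (tensor_algebra V) (nichols_ideal V) f (nichols_class V p) = nichols_class V (f p)"
proof -
  have "nichols_class V (f q) = nichols_class V (f p)" if "q \<in> nichols_class V p" for q
    using that assms(2)[of "q - p"]
    by (simp add: mem_nichols_class_iff nichols_class_eq_iff module_hom.diff[OF assms(1)])
  moreover have "p \<in> nichols_class V p" by (simp add: mem_nichols_class_iff nulls_zero)
  ultimately show ?thesis
    unfolding induced_map_def nichols_class_def[symmetric] by blast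
qed

lemma nichols_smult: "c \<odot>\<^bsub>nichols_algebra V\<^esub> nichols_class V p = nichols_class V (scale c p)"
  using induced_map_nichols_class[of "scale c" p]
  by (simp add: nichols_algebra_def quotient_algebra_def lin_iff nulls_scale
      lc.scale_right_distrib mult.commute)

lemma nichols_class_g_act: "nichols_g_act V g (nichols_class V p) = nichols_class V (g_act V g p)"
  unfolding nichols_g_act_def by (rule induced_map_nichols_class) (simp_all add: lin_iff nulls_g_act)

lemma abelian_monoid_nichols: "abelian_monoid (nichols_algebra V)"
  by (rule abelian_monoidI)
    (auto simp: carrier_nichols nichols_class_add nichols_zero keys_add_le add_ac
      intro!: imageI dest: keys_add_le[THEN subsetD, rotated 2])

lemma finsum_nichols_class:
  assumes "finite K" "\<And>x. x \<in> K \<Longrightarrow> keys (f x) \<subseteq> words_of V"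
  shows "(\<Oplus>\<^bsub>nichols_algebra V\<^esub>x\<in>K. nichols_class V (f x)) = nichols_class V (\<Sum>x\<in>K. f x)"
proof -
  interpret abelian_monoid "nichols_algebra V" by (rule abelian_monoid_nichols)
  have sum: "keys (sum f X) \<subseteq> words_of V" if "X \<subseteq> K" for X
    using lc.subspace_sum[OF subspace_keys[of "words_of V"], of X f] assms(2) that by auto
  have "(\<Oplus>\<^bsub>nichols_algebra V\<^esub>x\<in>X. nichols_class V (f x)) = nichols_class V (\<Sum>x\<in>X. f x)"
    if "finite X" "X \<subseteq> K" for X
    using that
  proof (induction X)
    case (insert x X)
    then show ?case
      using assms(2) sum[of X] by (subst finsum_insert) (auto simp: nichols_class_closed nichols_class_add)
  qed (simp add: nichols_zero)
  then show ?thesis using assms(1) by simp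
qed

section \<open>Multiplication as a map on the tensor square\<close>

definition nichols_rep :: "'k words set \<Rightarrow> 'k words" where
  "nichols_rep x = (SOME p. keys p \<subseteq> words_of V \<and> nichols_class V p = x)"

lemma nichols_rep:
  assumes "x \<in> carrier (nichols_algebra V)"
  shows "keys (nichols_rep x) \<subseteq> words_of V" "nichols_class V (nichols_rep x) = x"
proof -
  have "\<exists>p. keys p \<subseteq> words_of V \<and> nichols_class V p = x" using assms by (auto simp: carrier_nichols)
  from someI_ex[OF this] show "keys (nichols_rep x) \<subseteq> words_of V" "nichols_class V (nichols_rep x) = x"
    unfolding nichols_rep_def by blast+
qed

lemma nichols_rep_diff:
  "x \<in> carrier (nichols_algebra V) \<Longrightarrow> nichols_class V p = x \<Longrightarrow> nichols_rep x - p \<in> nulls V"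
  using nichols_rep(2)[of x] by (simp flip: nichols_class_eq_iff)

text \<open>Lifts the multiplication \<open>B \<otimes> B \<longrightarrow> B\<close> to formal
  combinations, with values in the tensor algebra. It is exactly linear; the choice of
  representatives only matters modulo the radical.\<close>

definition mult_map :: "(('k words set \<times> 'k words set) \<Rightarrow>\<^sub>0 'k) \<Rightarrow> 'k words" where
  "mult_map = lin_ext (\<lambda>(x, y). nichols_rep x * nichols_rep y)"

lemma mult_map_simps [simp]:
  "mult_map (y + z) = mult_map y + mult_map z" "mult_map (y - z) = mult_map y - mult_map z"
  "mult_map (scale c z) = scale c (mult_map z)" "mult_map 0 = 0"
  "mult_map (single (a, b) c) = scale c (nichols_rep a * nichols_rep b)"
  by (simp_all add: mult_map_def)

text \<open>Chosen representatives respect sums and scalars up to an element of the radical. The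
  radical is a two-sided ideal, so the error stays in it after multiplication by the other
  factor.\<close>

lemma mult_map_relators:
  assumes "z \<in> bilinear_relators (nichols_algebra V) (nichols_algebra V)"
  shows "keys z \<subseteq> carrier (nichols_algebra V) \<times> carrier (nichols_algebra V) \<and> mult_map z \<in> nulls V"
proof -
  let ?B = "nichols_algebra V" and ?r = nichols_rep
  have add: "a \<oplus>\<^bsub>?B\<^esub> a' \<in> carrier ?B \<and> ?r (a \<oplus>\<^bsub>?B\<^esub> a') - ?r a - ?r a' \<in> nulls V"
    if "a \<in> carrier ?B" "a' \<in> carrier ?B" for a a'
  proof -
    note r = nichols_rep[OF that(1)] nichols_rep[OF that(2)]
    have eq: "a \<oplus>\<^bsub>?B\<^esub> a' = nichols_class V (?r a + ?r a')"
      using nichols_class_add[OF r(1,3)] unfolding r(2,4) .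
    have closed: "a \<oplus>\<^bsub>?B\<^esub> a' \<in> carrier ?B"
      unfolding eq by (rule nichols_class_closed[OF keys_add_le[OF r(1,3)]])
    show ?thesis using closed nichols_rep_diff[OF closed eq[symmetric]] unfolding diff_diff_eq ..
  qed
  have smult: "c \<odot>\<^bsub>?B\<^esub> a \<in> carrier ?B \<and> ?r (c \<odot>\<^bsub>?B\<^esub> a) - scale c (?r a) \<in> nulls V"
    if "a \<in> carrier ?B" for c a
  proof -
    note r = nichols_rep[OF that]
    have eq: "c \<odot>\<^bsub>?B\<^esub> a = nichols_class V (scale c (?r a))"
      using nichols_smult[of c "?r a"] unfolding r(2) .
    have closed: "c \<odot>\<^bsub>?B\<^esub> a \<in> carrier ?B"
      unfolding eq by (rule nichols_class_closed[OF keys_scale_le[OF r(1)]])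
    show ?thesis using closed nichols_rep_diff[OF closed eq[symmetric]] ..
  qed
  note left = nulls_mult_left[where V = V] and right = nulls_mult_right[where V = V]
  have keys: "keys (single x (1::'k) - y - z) \<subseteq> S" if "x \<in> S" "keys y \<subseteq> S" "keys z \<subseteq> S"
    for x and y z :: "('k words set \<times> 'k words set) \<Rightarrow>\<^sub>0 'k" and S
    using that by (intro keys_diff_le) auto
  have keys': "keys (single x (1::'k) - y) \<subseteq> S" if "x \<in> S" "keys y \<subseteq> S"
    for x and y z :: "('k words set \<times> 'k words set) \<Rightarrow>\<^sub>0 'k" and S
    using that by (intro keys_diff_le) auto
  from assms consider
    (1) a a' b where "z = single (a \<oplus>\<^bsub>?B\<^esub> a', b) 1 - single (a, b) 1 - single (a', b) 1"
      "a \<in> carrier ?B" "a' \<in> carrier ?B" "b \<in> carrier ?B"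
    | (2) a b b' where "z = single (a, b \<oplus>\<^bsub>?B\<^esub> b') 1 - single (a, b) 1 - single (a, b') 1"
      "a \<in> carrier ?B" "b \<in> carrier ?B" "b' \<in> carrier ?B"
    | (3) c a b where "z = single (c \<odot>\<^bsub>?B\<^esub> a, b) 1 - single (a, b) c" "a \<in> carrier ?B" "b \<in> carrier ?B"
    | (4) c a b where "z = single (a, c \<odot>\<^bsub>?B\<^esub> b) 1 - single (a, b) c" "a \<in> carrier ?B" "b \<in> carrier ?B"
    unfolding bilinear_relators_def by blast
  then show ?thesis
  proof cases
    case 1
    have "mult_map z = (?r (a \<oplus>\<^bsub>?B\<^esub> a') - ?r a - ?r a') * ?r b"
      by (simp add: 1(1) algebra_simps)
    then show ?thesis using right add[OF 1(2,3)] nichols_rep[OF 1(4)] 1 by (simp add: keys)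
  next
    case 2
    have "mult_map z = ?r a * (?r (b \<oplus>\<^bsub>?B\<^esub> b') - ?r b - ?r b')"
      by (simp add: 2(1) algebra_simps)
    then show ?thesis using left add[OF 2(3,4)] nichols_rep[OF 2(2)] 2 by (simp add: keys)
  next
    case 3
    have "mult_map z = (?r (c \<odot>\<^bsub>?B\<^esub> a) - scale c (?r a)) * ?r b"
      by (simp add: 3(1) algebra_simps)
    then show ?thesis using right smult[OF 3(2)] nichols_rep[OF 3(3)] 3 by (simp add: keys')
  next
    case 4
    have "mult_map z = ?r a * (?r (c \<odot>\<^bsub>?B\<^esub> b) - scale c (?r b))"
      by (simp add: 4(1) algebra_simps)
    then show ?thesis using left smult[OF 4(3)] nichols_rep[OF 4(2)] 4 by (simp add: keys')
  qed
qed

text \<open>Well-definedness: the combinations with product in the radical form a subspace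
  containing all relators, hence their span.\<close>

lemma tensor_class_eq_imp_mult_map:
  assumes "tensor_class (nichols_algebra V) (nichols_algebra V) y = tensor_class (nichols_algebra V) (nichols_algebra V) z"
  shows "nichols_class V (mult_map y) = nichols_class V (mult_map z)"
proof -
  let ?B = "nichols_algebra V"
  let ?S = "{x. keys x \<subseteq> carrier ?B \<times> carrier ?B \<and> mult_map x \<in> nulls V}"
  let ?U = "span_in (formal_pairs ?B ?B) (bilinear_relators ?B ?B)"
  have "is_subspace (formal_pairs ?B ?B) ?S"
    unfolding is_subspace_def
    by (simp add: keys_add_le keys_scale_le nulls_zero nulls_add nulls_scale) blast
  then have U: "?U \<subseteq> ?S" by (rule span_in_minimal) (use mult_map_relators in blast)
  have "0 + y \<in> tensor_class ?B ?B y"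
    using span_in_zero[of "formal_pairs ?B ?B"] by (auto simp: tensor_class_def a_r_coset_def')
  then have "y \<in> tensor_class ?B ?B z" using assms by simp
  then obtain h where "h \<in> ?U" "y = h + z" by (auto simp: tensor_class_def a_r_coset_def')
  then show ?thesis using U by (auto simp: nichols_class_eq_iff)
qed

section \<open>From skew-primitivity to a skew derivation\<close>

lemma tensor_act_single:
  "tensor_act act Z (single (a, b) 1) = lin_ext (\<lambda>z. single (act (fst z) a, act (snd z) b) 1) Z"
  for Z :: "('h \<times> 'h) \<Rightarrow>\<^sub>0 'k"
  by (simp add: tensor_act_def lin_ext_def)

text \<open>Skew-primitivity is an equality in \<open>B \<otimes> B\<close>. Multiplying out, its
  left side becomes the action on the product \<open>ab\<close>, by the module algebra axiom, and
  its right side the two terms of the Leibniz rule.\<close>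

lemma skew_derivation:
  assumes coproduct: "is_boson_coproduct V \<Delta>"
    and action: "is_nichols_action V \<Delta> act"
    and f: "f \<in> carrier (nichols_algebra (dual_yd V))"
    and A: "A \<subseteq> carrier (nichols_algebra V)"
    and skew: "skew_primitive_on V \<Delta> act A h f"
    and a: "a \<in> A" and b: "b \<in> A"
  shows "act (boson_of V f) (a \<otimes>\<^bsub>nichols_algebra V\<^esub> b) =
    act (boson_of V f) a \<otimes>\<^bsub>nichols_algebra V\<^esub> b \<oplus>\<^bsub>nichols_algebra V\<^esub>
    nichols_g_act V (- h) a \<otimes>\<^bsub>nichols_algebra V\<^esub> act (boson_of V f) b"
proof -
  let ?B = "nichols_algebra V" and ?H = "dual_boson V"
  let ?F = "boson_of V f" and ?E = "boson_grp V (- h)"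
  have act_closed: "act F \<rho> \<in> carrier ?B" if "F \<in> carrier ?H" "\<rho> \<in> carrier ?B" for F \<rho>
    using action that by (simp add: is_nichols_action_def Let_def)
  have act_grp: "act (boson_grp V g) \<rho> = nichols_g_act V g \<rho>" if "\<rho> \<in> carrier ?B" for g \<rho>
    using action that unfolding is_nichols_action_def Let_def by blast
  have act_mult: "act F (\<rho> \<otimes>\<^bsub>?B\<^esub> \<rho>') =
      (\<Oplus>\<^bsub>?B\<^esub>x\<in>keys Z. lookup Z x \<odot>\<^bsub>?B\<^esub> (act (fst x) \<rho> \<otimes>\<^bsub>?B\<^esub> act (snd x) \<rho>'))"
    if "F \<in> carrier ?H" "\<rho> \<in> carrier ?B" "\<rho>' \<in> carrier ?B" "Z \<in> \<Delta> F" for F \<rho> \<rho>' Z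
    using action that unfolding is_nichols_action_def Let_def by blast
  have aB: "a \<in> carrier ?B" and bB: "b \<in> carrier ?B" using A a b by auto
  have F: "?F \<in> carrier ?H" by (rule boson_of_closed[OF V f])
  have "\<Delta> ?F \<in> carrier (tensor_product ?H ?H)"
    using coproduct ring_hom_closed[OF _ F] unfolding is_boson_coproduct_def alg_hom_def by blast
  \<comment> \<open>Both the module algebra axiom and skew-primitivity speak about expressions for
    the coproduct, so one with entries in the bosonization is fixed.\<close>
  then obtain Z where Z: "keys Z \<subseteq> carrier ?H \<times> carrier ?H"
    and \<Delta>: "\<Delta> ?F = span_in (formal_pairs ?H ?H) (bilinear_relators ?H ?H) +>\<^bsub>formal_pairs ?H ?H\<^esub> Z"
    by (auto simp: tensor_product_def quotient_algebra_def FactRing_def A_RCOSETS_def')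
  have "0 + Z \<in> \<Delta> ?F"
    using span_in_zero[of "formal_pairs ?H ?H"] by (auto simp: \<Delta> a_r_coset_def')
  then have Z_in: "Z \<in> \<Delta> ?F" by simp
  let ?r = nichols_rep
  have Z_carrier: "act (fst x) a \<in> carrier ?B" "act (snd x) b \<in> carrier ?B" if "x \<in> keys Z" for x
    using subsetD[OF Z that] act_closed aB bB by (auto simp: mem_Times_iff)
  let ?t = "\<lambda>x. scale (lookup Z x) (?r (act (fst x) a) * ?r (act (snd x) b))"
  have t: "keys (?t x) \<subseteq> words_of V"
      "lookup Z x \<odot>\<^bsub>?B\<^esub> (act (fst x) a \<otimes>\<^bsub>?B\<^esub> act (snd x) b) = nichols_class V (?t x)" if "x \<in> keys Z" for x
  proof -
    note r = nichols_rep[OF Z_carrier(1)[OF that]] nichols_rep[OF Z_carrier(2)[OF that]]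
    show "keys (?t x) \<subseteq> words_of V" using r by (intro keys_scale_le keys_mult_words_of)
    show "lookup Z x \<odot>\<^bsub>?B\<^esub> (act (fst x) a \<otimes>\<^bsub>?B\<^esub> act (snd x) b) = nichols_class V (?t x)"
      using nichols_class_mult[OF r(1,3)] r by (simp add: nichols_smult)
  qed
  interpret abelian_monoid ?B by (rule abelian_monoid_nichols)
  have "act ?F (a \<otimes>\<^bsub>?B\<^esub> b) = (\<Oplus>\<^bsub>?B\<^esub>x\<in>keys Z. nichols_class V (?t x))"
    unfolding act_mult[OF F aB bB Z_in]
    by (rule finsum_cong') (use t nichols_class_closed in auto)
  also have "\<dots> = nichols_class V (\<Sum>x\<in>keys Z. ?t x)"
    by (rule finsum_nichols_class) (use t in auto)
  also have "(\<Sum>x\<in>keys Z. ?t x) = mult_map (tensor_act act Z (single (a, b) 1))"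
    unfolding tensor_act_single unfolding lin_ext_def
    using module_hom.sum[of scale scale mult_map "\<lambda>x. single (act (fst x) a, act (snd x) b) (lookup Z x)" "keys Z"]
    by (simp add: lin_iff)
  also have "nichols_class V \<dots> = nichols_class V (mult_map (tensor_act act
      (single (?F, \<one>\<^bsub>?H\<^esub>) 1 + single (?E, ?F) 1) (single (a, b) 1)))"
    by (rule tensor_class_eq_imp_mult_map)
      (use skew Z_in a b in \<open>simp add: skew_primitive_on_def\<close>)
  also have "\<dots> = nichols_class V (?r (act ?F a) * ?r (act \<one>\<^bsub>?H\<^esub> b) + ?r (act ?E a) * ?r (act ?F b))"
    unfolding tensor_act_single by simp
  also have "\<one>\<^bsub>?H\<^esub> = boson_grp V 0"
    by (simp add: dual_boson_def smash_product_def boson_grp_def smash_el_def fun_eq_iff)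
  also have "act (boson_grp V 0) b = b"
    using bB by (auto simp: act_grp carrier_nichols nichols_class_g_act g_act_zero[OF V])
  also have "act ?E a = nichols_g_act V (- h) a" using act_grp[OF aB] .
  also have "nichols_class V (?r (act ?F a) * ?r b + ?r (nichols_g_act V (- h) a) * ?r (act ?F b)) =
      act ?F a \<otimes>\<^bsub>?B\<^esub> b \<oplus>\<^bsub>?B\<^esub> nichols_g_act V (- h) a \<otimes>\<^bsub>?B\<^esub> act ?F b"
  proof -
    have "nichols_g_act V (- h) a \<in> carrier ?B"
      using aB by (auto simp: carrier_nichols nichols_class_g_act keys_g_act)
    note r = nichols_rep[OF this] nichols_rep[OF act_closed[OF F aB]] nichols_rep[OF act_closed[OF F bB]]
      nichols_rep[OF bB]
    have "nichols_class V (?r (act ?F a) * ?r b) = act ?F a \<otimes>\<^bsub>?B\<^esub> b"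
      using nichols_class_mult[OF r(3,7)] r by simp
    moreover have "nichols_class V (?r (nichols_g_act V (- h) a) * ?r (act ?F b)) =
        nichols_g_act V (- h) a \<otimes>\<^bsub>?B\<^esub> act ?F b"
      using nichols_class_mult[OF r(1,5)] r by simp
    ultimately show ?thesis
      using nichols_class_add[OF keys_mult_words_of[OF r(3,7)] keys_mult_words_of[OF r(1,5)]] by simp
  qed
  finally show ?thesis .
qed

end

section \<open>Subalgebras generated by eigenvectors\<close>

definition word_subst :: "(nat \<Rightarrow> 'k::field words) \<Rightarrow> 'k words \<Rightarrow> 'k words" where
  "word_subst x = lin_ext (\<lambda>u. prod_list (map x u))"

lemma lin_word_subst: "lin (word_subst x)"
  by (simp add: word_subst_def)

lemma word_subst_simps [simp]:
  "word_subst x (p + q) = word_subst x p + word_subst x q"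
  "word_subst x (p - q) = word_subst x p - word_subst x q"
  "word_subst x (scale c p) = scale c (word_subst x p)"
  "word_subst x 0 = 0" "word_subst x (single [] 1) = single [] 1"
  by (simp_all add: word_subst_def one_words)

lemma word_subst_letter: "word_subst x (single [j] 1 * p) = x j * word_subst x p"
  by (rule lin_eq_on[where S = UNIV and F = "\<lambda>p. word_subst x (single [j] 1 * p)"])
    (auto simp: lin_iff distrib_left single_mult_single word_subst_def)

lemma word_subst_single_letter [simp]: "word_subst x (single [j] 1) = x j"
  using word_subst_letter[of x j "single [] 1"] by simp

lemma word_subst_mult: "word_subst x (p * q) = word_subst x p * word_subst x q"
proof -
  have "word_subst x (single u 1 * q) = word_subst x (single u 1) * word_subst x q" for u
  proof (induction u)
    case (Cons j u)
    then show ?case unfolding single_Cons[of j u] mult.assoc word_subst_letter by simp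
  qed simp
  then show ?thesis
    by (rule lin_eq_on[OF _ _ subset_UNIV, where F = "\<lambda>p. word_subst x (p * q)", rotated 2])
      (auto simp: lin_iff distrib_right)
qed

text \<open>\<open>x i\<close> is a lift of the basis vector \<open>w_i\<close> to the tensor
  algebra. A lift need not be an eigenvector, so \<open>x_chr\<close> is required only modulo the
  Nichols ideal.\<close>

locale nichols_eigenvectors =
  fixes V Y :: "('g::ab_group_add, 'k::field) diag_yd" and x :: "nat \<Rightarrow> 'k words"
  assumes V: "is_diag_yd V" and Y: "is_diag_yd Y"
    and keys_x: "\<And>i. i < yd_dim Y \<Longrightarrow> keys (x i) \<subseteq> words_of V"
    and x_Nil: "\<And>i. i < yd_dim Y \<Longrightarrow> lookup (x i) [] = 0"
    and x_chr: "\<And>i g. i < yd_dim Y \<Longrightarrow>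
      nichols_class V (g_act V g (x i)) = nichols_class V (scale (yd_chr Y i g) (x i))"
begin

abbreviation ev :: "'k words \<Rightarrow> 'k words set" where
  "ev p \<equiv> nichols_class V (word_subst x p)"

lemma words_nonempty: "words_of Z \<noteq> {}"
  using words_of_simps(1) by blast

lemma keys_word_subst: "keys p \<subseteq> words_of Y \<Longrightarrow> keys (word_subst x p) \<subseteq> words_of V"
proof (rule lin_keys[OF lin_word_subst])
  fix u assume "u \<in> words_of Y"
  then show "keys (word_subst x (single u 1)) \<subseteq> words_of V"
  proof (induction u)
    case (Cons j u)
    then show ?case unfolding single_Cons[of j u] word_subst_letter by (simp add: keys_mult_words_of keys_x)
  qed simp
qed

text \<open>A nonempty word becomes a product containing a factor without constant term. With
  \<open>nulls_Nil\<close>, this puts the kernel of \<open>ev\<close> into the augmentation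
  ideal.\<close>

lemma lookup_word_subst_Nil:
  assumes "keys p \<subseteq> words_of Y"
  shows "lookup (word_subst x p) [] = lookup p []"
  using assms
proof (induction p rule: words_induct)
  case (single u)
  then show ?case
  proof (cases u)
    case (Cons j v)
    then show ?thesis using single unfolding Cons single_Cons[of j v] word_subst_letter lookup_mult_Nil
      by (simp add: x_Nil lookup_single)
  qed simp
qed (simp_all add: lookup_add words_nonempty)

lemma nichols_class_mult_cong:
  assumes "nichols_class V a = nichols_class V a'" "nichols_class V b = nichols_class V b'"
    "keys a \<subseteq> words_of V" "keys a' \<subseteq> words_of V" "keys b \<subseteq> words_of V" "keys b' \<subseteq> words_of V"
  shows "nichols_class V (a * b) = nichols_class V (a' * b')"
  using assms by (simp flip: nichols_class_mult[OF V])

lemma ev_g_act: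
  assumes "keys p \<subseteq> words_of Y"
  shows "nichols_class V (g_act V g (word_subst x p)) = ev (g_act Y g p)"
  using assms
proof (induction p rule: words_induct)
  case (single u)
  then show ?case
  proof (induction u)
    case (Cons j u)
    then have u: "keys (single u (1::'k)) \<subseteq> words_of Y" "j < yd_dim Y" by auto
    have "nichols_class V (g_act V g (x j) * g_act V g (word_subst x (single u 1))) =
        nichols_class V (scale (yd_chr Y j g) (x j) * word_subst x (g_act Y g (single u 1)))"
      using Cons u by (intro nichols_class_mult_cong x_chr)
        (simp_all add: keys_g_act keys_scale_le keys_word_subst keys_x)
    then show ?case unfolding single_Cons[of j u] g_act_letter
      by (simp add: word_subst_letter g_act_mult)
  qed (simp add: g_act_single)
next
  case (add p q)
  then show ?case
    by (simp add: keys_word_subst keys_g_act flip: nichols_class_add[OF V])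
next
  case (scale c p)
  then show ?case by (simp flip: nichols_smult[OF V])
qed (rule words_nonempty)

section \<open>The generated subalgebra, its skew derivations and the kernel of evaluation\<close>

definition evA :: "'k words set set" where
  "evA = ev ` {p. keys p \<subseteq> words_of Y}"

lemma ev_add: "keys p \<subseteq> words_of Y \<Longrightarrow> keys q \<subseteq> words_of Y \<Longrightarrow>
    ev p \<oplus>\<^bsub>nichols_algebra V\<^esub> ev q = ev (p + q)"
  by (simp add: nichols_class_add[OF V] keys_word_subst)

lemma ev_mult: "keys p \<subseteq> words_of Y \<Longrightarrow> keys q \<subseteq> words_of Y \<Longrightarrow>
    ev p \<otimes>\<^bsub>nichols_algebra V\<^esub> ev q = ev (p * q)"
  by (simp add: nichols_class_mult[OF V] keys_word_subst word_subst_mult)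

lemma ev_smult: "c \<odot>\<^bsub>nichols_algebra V\<^esub> ev p = ev (scale c p)"
  by (simp add: nichols_smult[OF V])

lemma ev_one: "\<one>\<^bsub>nichols_algebra V\<^esub> = ev 1"
  by (simp add: nichols_one[OF V]) (simp add: one_words)

lemma evA_subalgebra: "is_subalgebra (nichols_algebra V) evA"
  unfolding is_subalgebra_def is_subspace_def
proof (intro conjI ballI allI)
  show "evA \<subseteq> carrier (nichols_algebra V)"
    by (auto simp: evA_def intro!: nichols_class_closed[OF V] keys_word_subst)
  show "\<zero>\<^bsub>nichols_algebra V\<^esub> \<in> evA"
    unfolding evA_def nichols_zero[OF V] by (rule image_eqI[of _ _ 0]) simp_all
  show "\<one>\<^bsub>nichols_algebra V\<^esub> \<in> evA"
    unfolding evA_def ev_one by (rule imageI) (simp add: one_words)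
next
  fix a b assume "a \<in> evA" "b \<in> evA"
  then obtain p q where "a = ev p" "b = ev q" "keys p \<subseteq> words_of Y" "keys q \<subseteq> words_of Y"
    by (auto simp: evA_def)
  then show "a \<oplus>\<^bsub>nichols_algebra V\<^esub> b \<in> evA" "a \<otimes>\<^bsub>nichols_algebra V\<^esub> b \<in> evA"
    unfolding evA_def by (simp_all add: ev_add ev_mult keys_add_le keys_mult_words_of del: word_subst_simps)
next
  fix c a assume "a \<in> evA"
  then show "c \<odot>\<^bsub>nichols_algebra V\<^esub> a \<in> evA"
    unfolding evA_def by (auto simp: ev_smult keys_scale_le simp del: word_subst_simps)
qed

lemma evA_generated:
  assumes W: "span_in (nichols_algebra V) ((\<lambda>i. nichols_class V (x i)) ` {..<yd_dim Y}) = W"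
  shows "generated_subalgebra (nichols_algebra V) W = evA"
proof
  have "nichols_class V (x i) \<in> evA" if "i < yd_dim Y" for i
    unfolding evA_def by (rule image_eqI[of _ _ "single [i] 1"]) (use that in simp_all)
  moreover have "is_subspace (nichols_algebra V) evA" using evA_subalgebra by (simp add: is_subalgebra_def)
  ultimately have "W \<subseteq> evA" unfolding W[symmetric] by (intro span_in_minimal) auto
  then show "generated_subalgebra (nichols_algebra V) W \<subseteq> evA"
    unfolding generated_subalgebra_def using evA_subalgebra by blast
next
  have "evA \<subseteq> S" if S: "is_subalgebra (nichols_algebra V) S" "W \<subseteq> S" for S
  proof -
    have "ev p \<in> S" if "keys p \<subseteq> words_of Y" for p
      using that
    proof (induction p rule: words_induct)
      case (single u)
      then show ?case
      proof (induction u)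
        case Nil
        then show ?case using S(1) unfolding is_subalgebra_def ev_one one_words by blast
      next
        case (Cons j u)
        then have "nichols_class V (x j) \<in> S"
          using S(2) unfolding W[symmetric] by (intro subsetD[OF S(2)[folded W]] span_in_superset) auto
        then have "nichols_class V (x j) \<otimes>\<^bsub>nichols_algebra V\<^esub> ev (single u 1) \<in> S"
          using Cons S(1) by (auto simp: is_subalgebra_def)
        moreover have "nichols_class V (x j) \<otimes>\<^bsub>nichols_algebra V\<^esub> ev (single u 1) = ev (single (j # u) 1)"
          using ev_mult[of "single [j] 1" "single u 1"] Cons.prems by (simp add: single_mult_single)
        ultimately show ?case by simp
      qed
    next
      case (add p q)
      then show ?case using S(1) ev_add[of p q] unfolding is_subalgebra_def is_subspace_def by metis
    next
      case (scale c p)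
      then show ?case using S(1) ev_smult[of c p] unfolding is_subalgebra_def is_subspace_def by metis
    qed (rule words_nonempty)
    then show ?thesis by (auto simp: evA_def)
  qed
  then show "evA \<subseteq> generated_subalgebra (nichols_algebra V) W"
    unfolding generated_subalgebra_def by blast
qed

text \<open>A skew derivation is determined by its values on generators. The letter step compares
  \<open>mult\<close> with \<open>rder_letter\<close>, where \<open>g_act Y (- yd_deg Y i)\<close>
  cancels the action on the remaining word.\<close>

lemma skew_derivation_ev:
  assumes closed: "\<And>a. a \<in> evA \<Longrightarrow> d a \<in> carrier (nichols_algebra V)"
    and add: "\<And>a b. a \<in> evA \<Longrightarrow> b \<in> evA \<Longrightarrow> d (a \<oplus>\<^bsub>nichols_algebra V\<^esub> b) = d a \<oplus>\<^bsub>nichols_algebra V\<^esub> d b"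
    and smult: "\<And>c a. a \<in> evA \<Longrightarrow> d (c \<odot>\<^bsub>nichols_algebra V\<^esub> a) = c \<odot>\<^bsub>nichols_algebra V\<^esub> d a"
    and mult: "\<And>a b. a \<in> evA \<Longrightarrow> b \<in> evA \<Longrightarrow> d (a \<otimes>\<^bsub>nichols_algebra V\<^esub> b) =
      d a \<otimes>\<^bsub>nichols_algebra V\<^esub> b \<oplus>\<^bsub>nichols_algebra V\<^esub>
      nichols_g_act V (- yd_deg Y i) a \<otimes>\<^bsub>nichols_algebra V\<^esub> d b"
    and gen: "\<And>j. j < yd_dim Y \<Longrightarrow> d (nichols_class V (x j)) =
      (if i = j then l else 0) \<odot>\<^bsub>nichols_algebra V\<^esub> \<one>\<^bsub>nichols_algebra V\<^esub>"
    and p: "keys p \<subseteq> words_of Y"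
  shows "d (ev p) = ev (scale l (g_act Y (- yd_deg Y i) (rder Y i p)))"
  using p
proof (induction p rule: words_induct)
  case (single u)
  then show ?case
  proof (induction u)
    case Nil
    have one: "ev 1 \<in> evA" unfolding evA_def by (rule imageI) (simp add: one_words)
    obtain r where r: "d (ev 1) = nichols_class V r" "keys r \<subseteq> words_of V"
      using closed[OF one] by (auto simp: carrier_nichols[OF V])
    \<comment> \<open>From \<open>1 = 1 * 1\<close> the Leibniz rule gives
      \<open>d 1 = d 1 + d 1\<close>, so \<open>d\<close> vanishes at the unit.\<close>
    have "d (ev 1) = nichols_class V (r + r)"
      using mult[OF one one] r
      by (simp add: ev_mult one_words nichols_class_g_act[OF V] nichols_class_mult[OF V]
          nichols_class_add[OF V] g_act_single)
    then have "r \<in> nulls V" using r by (simp add: nichols_class_eq_iff[OF V] nulls_neg)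
      (metis nulls_neg minus_minus)
    then show ?case using r by (simp add: one_words nichols_class_eq_iff[OF V])
  next
    case (Cons j u)
    let ?B = "nichols_algebra V" and ?g = "- yd_deg Y i"
    let ?r = "scale l (g_act Y ?g (rder Y i (single u 1)))"
    have u: "keys (single u (1::'k)) \<subseteq> words_of Y" "j < yd_dim Y" "keys (single [j] (1::'k)) \<subseteq> words_of Y"
      using Cons.prems by auto
    have r: "keys ?r \<subseteq> words_of Y" using u(1) by (intro keys_scale_le keys_g_act keys_rder)
    have c: "keys (scale (if i = j then l else 0) (1 :: 'k words)) \<subseteq> words_of Y"
      "keys (scale (yd_chr Y j ?g) (single [j] (1::'k))) \<subseteq> words_of Y"
      using u by (auto simp: one_words)
    have in_A: "ev (single [j] 1) \<in> evA" "ev (single u 1) \<in> evA"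
      unfolding evA_def by (rule imageI, use u in simp)+
    have "d (ev (single (j # u) 1)) = d (ev (single [j] 1) \<otimes>\<^bsub>?B\<^esub> ev (single u 1))"
      using ev_mult[OF u(3,1)] by (simp add: single_mult_single)
    also have "\<dots> = d (ev (single [j] 1)) \<otimes>\<^bsub>?B\<^esub> ev (single u 1) \<oplus>\<^bsub>?B\<^esub>
        nichols_g_act V ?g (ev (single [j] 1)) \<otimes>\<^bsub>?B\<^esub> d (ev (single u 1))"
      by (rule mult[OF in_A])
    also have "nichols_g_act V ?g (ev (single [j] 1)) = ev (scale (yd_chr Y j ?g) (single [j] 1))"
      using ev_g_act[OF u(3)] by (simp add: nichols_class_g_act[OF V] g_act_single)
    also have "d (ev (single [j] 1)) = ev (scale (if i = j then l else 0) 1)"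
      using gen[OF u(2)] unfolding ev_one ev_smult by simp
    also have "d (ev (single u 1)) = ev ?r"
      using Cons u by simp
    also have "ev (scale (if i = j then l else 0) 1) \<otimes>\<^bsub>?B\<^esub> ev (single u 1) \<oplus>\<^bsub>?B\<^esub>
        ev (scale (yd_chr Y j ?g) (single [j] 1)) \<otimes>\<^bsub>?B\<^esub> ev ?r =
        ev (scale (if i = j then l else 0) 1 * single u 1 + scale (yd_chr Y j ?g) (single [j] 1) * ?r)"
      using ev_mult[OF c(1) u(1)] ev_mult[OF c(2) r]
        ev_add[OF keys_mult_words_of[OF c(1) u(1)] keys_mult_words_of[OF c(2) r]]
      by (simp only:)
    also have "scale (if i = j then l else 0) 1 * single u 1 + scale (yd_chr Y j ?g) (single [j] 1) * ?r =
        scale l (g_act Y ?g (rder Y i (single (j # u) 1)))"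
      using u(1) unfolding single_Cons[of j u] rder_letter
      by (simp add: g_act_letter g_act_comp[OF Y] g_act_zero[OF Y] lc.scale_right_distrib mult_ac
          add_ac del: scale_single)
    finally show ?case .
  qed
next
  case (add p q)
  then have "ev p \<in> evA" "ev q \<in> evA" by (auto simp: evA_def)
  moreover have "keys (scale l (g_act Y (- yd_deg Y i) (rder Y i r))) \<subseteq> words_of Y"
    if "keys r \<subseteq> words_of Y" for r
    using that by (intro keys_scale_le keys_g_act keys_rder)
  ultimately show ?case
    using add assms(2)[of "ev p" "ev q"] unfolding ev_add[OF add(1,2)]
    by (simp add: ev_add lc.scale_right_distrib del: word_subst_simps)
next
  case (scale c p)
  then have "ev p \<in> evA" by (auto simp: evA_def)
  then show ?case
    using scale assms(3)[of "ev p" c] unfolding ev_smult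
    by (simp add: ev_smult mult_ac del: word_subst_simps)
qed (rule words_nonempty)

text \<open>The kernel of \<open>ev\<close> is stable under \<open>rder\<close>: \<open>d i\<close>
  takes the same value at equal classes, after which \<open>l i\<close> is undone by its inverse and
  the twist by acting with \<open>yd_deg Y i\<close>.\<close>

lemma kernel_subset_nulls:
  assumes d: "\<And>i p. i < yd_dim Y \<Longrightarrow> keys p \<subseteq> words_of Y \<Longrightarrow>
      d i (ev p) = ev (scale (l i) (g_act Y (- yd_deg Y i) (rder Y i p)))"
    and l: "\<And>i. i < yd_dim Y \<Longrightarrow> l i \<noteq> 0"
    and p: "keys p \<subseteq> words_of Y" "word_subst x p \<in> nulls V"
  shows "p \<in> nulls Y"
proof (rule nulls_coinduct[of _ "{p. keys p \<subseteq> words_of Y \<and> word_subst x p \<in> nulls V}"])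
  fix q assume "q \<in> {p. keys p \<subseteq> words_of Y \<and> word_subst x p \<in> nulls V}"
  then have q: "keys q \<subseteq> words_of Y" "word_subst x q \<in> nulls V" by auto
  have "word_subst x (rder Y i q) \<in> nulls V" for i
  proof (cases "i < yd_dim Y")
    case True
    let ?r = "g_act Y (- yd_deg Y i) (rder Y i q)"
    have r: "keys ?r \<subseteq> words_of Y" by (intro keys_g_act keys_rder q)
    \<comment> \<open>Linearity of \<open>d\<close> is not among the hypotheses; its value at zero
      is read off from the same formula with argument \<open>0\<close>.\<close>
    have "ev q = ev 0" using q(2) by (simp add: nichols_class_eq_iff[OF V])
    then have "ev (scale (l i) ?r) = ev (scale (l i) (g_act Y (- yd_deg Y i) (rder Y i 0)))"
      using d[OF True q(1)] d[OF True, of 0] by simp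
    then have "scale (l i) (word_subst x ?r) \<in> nulls V"
      by (simp add: nichols_class_eq_iff[OF V])
    then have "scale (inverse (l i)) (scale (l i) (word_subst x ?r)) \<in> nulls V" by (rule nulls_scale)
    then have "g_act V (yd_deg Y i) (word_subst x ?r) \<in> nulls V"
      using l[OF True] by (simp add: nulls_g_act)
    then have "ev (g_act Y (yd_deg Y i) ?r) = ev 0"
      unfolding ev_g_act[OF r, symmetric] by (simp add: nichols_class_eq_iff[OF V])
    moreover have "g_act Y (yd_deg Y i) ?r = rder Y i q"
      by (simp add: g_act_comp[OF Y] g_act_zero[OF Y] keys_rder q)
    ultimately show ?thesis by (simp add: nichols_class_eq_iff[OF V])
  qed (simp add: rder_eq_zero[OF q(1)] nulls_zero)
  then show "keys q \<subseteq> words_of Y \<and> lookup q [] = 0 \<and>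
      (\<forall>i. rder Y i q \<in> {p. keys p \<subseteq> words_of Y \<and> word_subst x p \<in> nulls V})"
    using q lookup_word_subst_Nil[OF q(1)] nulls_Nil[OF q(2)] by (simp add: keys_rder)
qed (use p in simp)

end

section \<open>Finite codimension\<close>

text \<open>Subspaces of finite-dimensional spaces are finite-dimensional, relative to
  \<open>N\<close>: spanning vectors are removed one at a time, with an element of \<open>S\<close>
  as pivot if some coordinate at \<open>x\<close> is needed. That \<open>Z\<close> lies in
  \<open>S\<close> allows it to be pulled back along a map with image \<open>S\<close>.\<close>

lemma finite_codim_subspace:
  fixes S N X :: "('x \<Rightarrow>\<^sub>0 'k::field) set"
  assumes "finite X" "lc.subspace S" "S \<subseteq> lc.span (X \<union> N)"
  shows "\<exists>Z. finite Z \<and> Z \<subseteq> S \<and> S \<subseteq> lc.span (Z \<union> N)"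
  using assms
proof (induction X arbitrary: S)
  case (insert x X)
  let ?S = "S \<inter> lc.span (X \<union> N)"
  have "lc.subspace ?S" by (intro lc.subspace_inter insert lc.subspace_span)
  then obtain Z where Z: "finite Z" "Z \<subseteq> ?S" "?S \<subseteq> lc.span (Z \<union> N)"
    using insert.IH[of ?S] by blast
  show ?case
  proof (cases "S \<subseteq> lc.span (X \<union> N)")
    case True
    then show ?thesis using Z by blast
  next
    case False
    then obtain s0 where s0: "s0 \<in> S" "s0 \<notin> lc.span (X \<union> N)" by blast
    have break: "\<exists>k. s - scale k x \<in> lc.span (X \<union> N)" if "s \<in> S" for s
      using insert.prems(2) that lc.span_breakdown_eq[of s x "X \<union> N"] by auto
    then obtain k0 where k0: "s0 - scale k0 x \<in> lc.span (X \<union> N)" using s0 by blast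
    with s0 have "k0 \<noteq> 0" by auto
    have "s \<in> lc.span (insert s0 Z \<union> N)" if s: "s \<in> S" for s
    proof -
      obtain k where k: "s - scale k x \<in> lc.span (X \<union> N)" using break[OF s] by blast
      let ?t = "s - scale (k / k0) s0"
      have "?t = (s - scale k x) - scale (k / k0) (s0 - scale k0 x)"
        using \<open>k0 \<noteq> 0\<close> by (simp add: lc.scale_right_diff_distrib)
      also have "\<dots> \<in> lc.span (X \<union> N)" by (intro lc.span_diff lc.span_scale k k0)
      finally have "?t \<in> lc.span (X \<union> N)" .
      moreover have "?t \<in> S"
        using insert.prems(1) s s0 by (intro lc.subspace_diff lc.subspace_scale)
      ultimately have "?t \<in> lc.span (Z \<union> N)" using Z by blast
      then show ?thesis using lc.span_breakdown_eq[of s s0 "Z \<union> N"] by auto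
    qed
    then show ?thesis using Z s0 by (intro exI[of _ "insert s0 Z"]) auto
  qed
next
  case empty
  then show ?case by (intro exI[of _ "{}"]) simp
qed

text \<open>Moves the question from spans of cosets to spans in the space of words, where vector
  space theory is available.\<close>

lemma finite_dim_nichols:
  assumes V: "is_diag_yd V"
  shows "finite_dim (nichols_algebra V) \<longleftrightarrow>
    (\<exists>X. finite X \<and> X \<subseteq> {p. keys p \<subseteq> words_of V} \<and> {p. keys p \<subseteq> words_of V} \<subseteq> lc.span (X \<union> nulls V))"
    (is "?L \<longleftrightarrow> ?R")
proof
  let ?B = "nichols_algebra V" and ?T = "{p. keys p \<subseteq> words_of V}"
  assume ?L
  then obtain X where X: "finite X" "X \<subseteq> carrier ?B" "span_in ?B X = carrier ?B"
    unfolding finite_dim_def by blast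
  then obtain X' where X': "finite X'" "X' \<subseteq> ?T" "X = nichols_class V ` X'"
    unfolding carrier_nichols[OF V] by (metis finite_subset_image)
  let ?U = "nichols_class V ` (?T \<inter> lc.span (X' \<union> nulls V))"
  have "is_subspace ?B ?U"
    unfolding is_subspace_def
  proof (intro conjI ballI allI)
    show "?U \<subseteq> carrier ?B" by (auto intro: nichols_class_closed[OF V])
    show "\<zero>\<^bsub>?B\<^esub> \<in> ?U" unfolding nichols_zero[OF V] by (rule imageI) (simp add: lc.span_zero)
  next
    fix a b assume "a \<in> ?U" "b \<in> ?U"
    then obtain p q where p: "a = nichols_class V p" "keys p \<subseteq> words_of V" "p \<in> lc.span (X' \<union> nulls V)"
      and q: "b = nichols_class V q" "keys q \<subseteq> words_of V" "q \<in> lc.span (X' \<union> nulls V)" by blast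
    then show "a \<oplus>\<^bsub>?B\<^esub> b \<in> ?U"
      unfolding p(1) q(1) nichols_class_add[OF V p(2) q(2)]
      by (intro imageI IntI CollectI keys_add_le lc.span_add)
  next
    fix c a assume "a \<in> ?U"
    then obtain p where p: "a = nichols_class V p" "keys p \<subseteq> words_of V" "p \<in> lc.span (X' \<union> nulls V)"
      by blast
    then show "c \<odot>\<^bsub>?B\<^esub> a \<in> ?U"
      unfolding p(1) nichols_smult[OF V] by (intro imageI IntI CollectI keys_scale_le lc.span_scale)
  qed
  moreover have "X \<subseteq> ?U" using X'(2) by (auto simp: X'(3) intro!: imageI lc.span_base)
  ultimately have U: "carrier ?B \<subseteq> ?U" using X(3) span_in_minimal by metis
  have "p \<in> lc.span (X' \<union> nulls V)" if p: "keys p \<subseteq> words_of V" for p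
  proof -
    obtain q where q: "nichols_class V p = nichols_class V q" "q \<in> lc.span (X' \<union> nulls V)"
      using U nichols_class_closed[OF V p] by blast
    then have "p - q \<in> lc.span (X' \<union> nulls V)"
      by (intro lc.span_base) (simp add: nichols_class_eq_iff[OF V])
    then show ?thesis using lc.span_add[OF _ q(2)] by fastforce
  qed
  then show ?R using X' by blast
next
  let ?B = "nichols_algebra V" and ?T = "{p. keys p \<subseteq> words_of V}"
  assume ?R
  then obtain X where X: "finite X" "X \<subseteq> ?T" "?T \<subseteq> lc.span (X \<union> nulls V)" by blast
  let ?X = "nichols_class V ` X"
  have "is_subspace ?B (carrier ?B)"
    unfolding is_subspace_def
  proof (intro conjI ballI allI nichols_zero_closed V order_refl)
    fix a b assume "a \<in> carrier ?B" "b \<in> carrier ?B"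
    then obtain p q where "a = nichols_class V p" "b = nichols_class V q"
      "keys p \<subseteq> words_of V" "keys q \<subseteq> words_of V" unfolding carrier_nichols[OF V] by blast
    then show "a \<oplus>\<^bsub>?B\<^esub> b \<in> carrier ?B"
      by (simp add: nichols_class_add[OF V] nichols_class_closed[OF V] keys_add_le)
  next
    fix c a assume "a \<in> carrier ?B"
    then obtain p where "a = nichols_class V p" "keys p \<subseteq> words_of V"
      unfolding carrier_nichols[OF V] by blast
    then show "c \<odot>\<^bsub>?B\<^esub> a \<in> carrier ?B"
      by (simp add: nichols_smult[OF V] nichols_class_closed[OF V] keys_scale_le)
  qed
  then have "span_in ?B ?X \<subseteq> carrier ?B"
    using X(2) nichols_class_closed[OF V] by (intro span_in_minimal) auto
  moreover have "nichols_class V p \<in> span_in ?B ?X" if p: "keys p \<subseteq> words_of V" for p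
  proof -
    let ?U = "{p. keys p \<subseteq> words_of V \<and> nichols_class V p \<in> span_in ?B ?X}"
    have "lc.subspace ?U"
      unfolding lc.subspace_def
      using span_in_zero[of ?B ?X] span_in_add[of _ ?B ?X] span_in_smult[of _ ?B ?X]
      by (auto simp: nichols_zero[OF V] keys_add_le keys_scale_le
          simp flip: nichols_class_add[OF V] nichols_smult[OF V])
    moreover have "nichols_class V h = \<zero>\<^bsub>?B\<^esub>" if "h \<in> nulls V" for h
      using that by (simp add: nichols_zero[OF V] nichols_class_eq_iff[OF V])
    then have "X \<union> nulls V \<subseteq> ?U"
      using X(2) span_in_zero[of ?B ?X] by (auto intro: span_in_superset dest: subsetD[OF nulls_keys])
    ultimately have "lc.span (X \<union> nulls V) \<subseteq> ?U" by (intro lc.span_minimal)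
    then show ?thesis using X(3) p by blast
  qed
  ultimately have "span_in ?B ?X = carrier ?B" unfolding carrier_nichols[OF V] by blast
  then show ?L unfolding finite_dim_def
    using X nichols_class_closed[OF V] by (intro exI[of _ ?X]) auto
qed

section \<open>The quotient map and transfer of finite dimension\<close>

context nichols_eigenvectors
begin

text \<open>The image of the substitution is a subspace of \<open>T(V)\<close>, hence finitely
  spanned modulo the radical of \<open>V\<close> by elements of that image. Preimages of these span
  \<open>T(Y)\<close> modulo the kernel, which lies in the radical of \<open>Y\<close>.\<close>

lemma finite_dim_transfer:
  assumes kernel: "\<And>p. keys p \<subseteq> words_of Y \<Longrightarrow> word_subst x p \<in> nulls V \<Longrightarrow> p \<in> nulls Y"
    and fin: "finite_dim (nichols_algebra V)"
  shows "finite_dim (nichols_algebra Y)"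
proof -
  let ?T = "{p. keys p \<subseteq> words_of Y} :: 'k words set"
  obtain X where X: "finite X" "{p. keys p \<subseteq> words_of V} \<subseteq> lc.span (X \<union> nulls V)"
    using fin unfolding finite_dim_nichols[OF V] by blast
  have "word_subst x ` ?T \<subseteq> lc.span (X \<union> nulls V)" using X(2) keys_word_subst by auto
  then obtain Z where Z: "finite Z" "Z \<subseteq> word_subst x ` ?T" "word_subst x ` ?T \<subseteq> lc.span (Z \<union> nulls V)"
    using finite_codim_subspace[OF X(1) module_hom.subspace_image[OF lin_word_subst subspace_keys]] by metis
  obtain Z' where Z': "finite Z'" "Z' \<subseteq> ?T" "Z = word_subst x ` Z'"
    using finite_subset_image[OF Z(1,2)] by blast
  have "p \<in> lc.span (Z' \<union> nulls Y)" if p: "keys p \<subseteq> words_of Y" for p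
  proof -
    have "word_subst x p \<in> lc.span (Z \<union> nulls V)" using Z(3) p by blast
    then obtain a b where ab: "word_subst x p = a + b" "a \<in> lc.span Z" "b \<in> lc.span (nulls V)"
      unfolding lc.span_Un by blast
    then obtain q where q: "q \<in> lc.span Z'" "a = word_subst x q"
      unfolding Z'(3) module_hom.span_image[OF lin_word_subst] by blast
    have "keys q \<subseteq> words_of Y" using q(1) lc.span_minimal[OF Z'(2) subspace_keys] by blast
    moreover have "word_subst x (p - q) \<in> nulls V"
      using ab q lc.span_minimal[OF order_refl subspace_nulls, of V] by auto
    ultimately have "p - q \<in> nulls Y" using p by (intro kernel keys_diff_le)
    then have "p - q \<in> lc.span (Z' \<union> nulls Y)" by (intro lc.span_base) simp
    moreover have "q \<in> lc.span (Z' \<union> nulls Y)" using q(1) lc.span_mono[of Z' "Z' \<union> nulls Y"] by blast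
    ultimately show ?thesis using lc.span_add by fastforce
  qed
  then show ?thesis unfolding finite_dim_nichols[OF Y] using Z' by blast
qed

text \<open>The kernel condition makes the class of a preimage independent of its choice, so a
  chosen preimage defines the map, and all properties follow from its value on
  \<open>ev p\<close>.\<close>

lemma quotient_map:
  assumes kernel: "\<And>p. keys p \<subseteq> words_of Y \<Longrightarrow> word_subst x p \<in> nulls V \<Longrightarrow> p \<in> nulls Y"
  shows "\<exists>\<phi> \<in> alg_hom (nichols_algebra V\<lparr>carrier := evA\<rparr>) (nichols_algebra Y).
    \<phi> ` evA = carrier (nichols_algebra Y) \<and>
    (\<forall>i<yd_dim Y. \<phi> (nichols_class V (x i)) = nichols_gen Y i)"
proof -
  define lift where "lift a = (SOME p. keys p \<subseteq> words_of Y \<and> ev p = a)" for a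
  define \<phi> where "\<phi> a = nichols_class Y (lift a)" for a
  have \<phi>: "\<phi> (ev p) = nichols_class Y p" if p: "keys p \<subseteq> words_of Y" for p
  proof -
    have "\<exists>q. keys q \<subseteq> words_of Y \<and> ev q = ev p" using p by blast
    from someI_ex[OF this] have lift: "keys (lift (ev p)) \<subseteq> words_of Y" "ev (lift (ev p)) = ev p"
      unfolding lift_def by blast+
    then have "lift (ev p) - p \<in> nulls Y"
      using p by (intro kernel keys_diff_le) (simp_all add: nichols_class_eq_iff[OF V])
    then show ?thesis by (simp add: \<phi>_def nichols_class_eq_iff[OF Y])
  qed
  have cases: "\<exists>p. keys p \<subseteq> words_of Y \<and> a = ev p" if "a \<in> evA" for a
    using that by (auto simp: evA_def)
  have "\<phi> \<in> ring_hom (nichols_algebra V\<lparr>carrier := evA\<rparr>) (nichols_algebra Y)"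
  proof (rule ring_hom_memI)
    fix a assume "a \<in> carrier (nichols_algebra V\<lparr>carrier := evA\<rparr>)"
    then obtain p where "keys p \<subseteq> words_of Y" "a = ev p" using cases by auto
    then show "\<phi> a \<in> carrier (nichols_algebra Y)" by (simp add: \<phi> nichols_class_closed[OF Y])
  next
    fix a b assume "a \<in> carrier (nichols_algebra V\<lparr>carrier := evA\<rparr>)" "b \<in> carrier (nichols_algebra V\<lparr>carrier := evA\<rparr>)"
    then obtain p q where p: "keys p \<subseteq> words_of Y" "a = ev p" and q: "keys q \<subseteq> words_of Y" "b = ev q"
      using cases[of a] cases[of b] by auto
    show "\<phi> (a \<otimes>\<^bsub>nichols_algebra V\<lparr>carrier := evA\<rparr>\<^esub> b) = \<phi> a \<otimes>\<^bsub>nichols_algebra Y\<^esub> \<phi> b"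
      using p q by (simp add: ev_mult \<phi> keys_mult_words_of nichols_class_mult[OF Y] del: word_subst_simps)
    show "\<phi> (a \<oplus>\<^bsub>nichols_algebra V\<lparr>carrier := evA\<rparr>\<^esub> b) = \<phi> a \<oplus>\<^bsub>nichols_algebra Y\<^esub> \<phi> b"
      using p q by (simp add: ev_add \<phi> keys_add_le nichols_class_add[OF Y] del: word_subst_simps)
  next
    have "keys (1 :: 'k words) \<subseteq> words_of Y" by (simp add: one_words)
    then show "\<phi> \<one>\<^bsub>nichols_algebra V\<lparr>carrier := evA\<rparr>\<^esub> = \<one>\<^bsub>nichols_algebra Y\<^esub>"
      by (simp add: ev_one \<phi> nichols_one[OF Y])
  qed
  moreover have "\<phi> (c \<odot>\<^bsub>nichols_algebra V\<^esub> a) = c \<odot>\<^bsub>nichols_algebra Y\<^esub> \<phi> a" if "a \<in> evA" for c a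
    using cases[OF that] by (auto simp: ev_smult \<phi> keys_scale_le nichols_smult[OF Y] simp del: word_subst_simps)
  moreover have "\<phi> ` evA = carrier (nichols_algebra Y)"
    unfolding evA_def carrier_nichols[OF Y] image_image by (rule image_cong) (auto simp: \<phi>)
  moreover have "\<phi> (nichols_class V (x i)) = nichols_gen Y i" if "i < yd_dim Y" for i
    using \<phi>[of "single [i] 1"] that by (simp add: nichols_gen_def)
  ultimately show ?thesis by (intro bexI[of _ \<phi>]) (auto simp: alg_hom_def)
qed

end

theorem corollary2:
  fixes V Y :: "('g::ab_group_add, 'k::field_char_0) diag_yd"
    and \<iota> :: "'k words set \<Rightarrow> 'k words set"
    and \<Delta> :: "('g \<Rightarrow> 'k words set) \<Rightarrow>
                ((('g \<Rightarrow> 'k words set) \<times> ('g \<Rightarrow> 'k words set)) \<Rightarrow>\<^sub>0 'k) set"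
    and act :: "('g \<Rightarrow> 'k words set) \<Rightarrow> 'k words set \<Rightarrow> 'k words set"
    and n :: nat
    and W A :: "'k words set set"
    and w :: "nat \<Rightarrow> 'k words set"
    and lam :: "nat \<Rightarrow> 'k"
  assumes V: "is_diag_yd V"
    and iota: "is_dual_iso V \<iota>"
    and coproduct: "is_boson_coproduct V \<Delta>"
    and action: "is_nichols_action V \<Delta> act"
    and W: "W \<subseteq> nichols_plus V" "is_yd_submodule V W"
    and basis: "is_canonical_basis V W w Y" "yd_dim Y = n"
    and A: "A = generated_subalgebra (nichols_algebra V) W"
    and lam: "\<And>i. i < n \<Longrightarrow> lam i \<noteq> 0"
    and skew: "\<And>i. i < n \<Longrightarrow> skew_primitive_on V \<Delta> act A (yd_deg Y i) (\<iota> (w i))"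
    and pairing: "\<And>i j. i < n \<Longrightarrow> j < n \<Longrightarrow>
          act (boson_of V (\<iota> (w i))) (w j) =
            (if i = j then lam i else 0) \<odot>\<^bsub>nichols_algebra V\<^esub> \<one>\<^bsub>nichols_algebra V\<^esub>"
  shows "(\<exists>\<phi> \<in> alg_hom (nichols_algebra V\<lparr>carrier := A\<rparr>) (nichols_algebra Y).
            \<phi> ` A = carrier (nichols_algebra Y) \<and> (\<forall>i<n. \<phi> (w i) = nichols_gen Y i)) \<and>
         (\<not> finite_dim (nichols_algebra Y) \<longrightarrow> \<not> finite_dim (nichols_algebra V))"
proof -
  let ?B = "nichols_algebra V"
  have Y: "is_diag_yd Y" and span: "span_in ?B (w ` {..<n}) = W"
    and w_chr: "\<And>i g. i < n \<Longrightarrow> nichols_g_act V g (w i) = yd_chr Y i g \<odot>\<^bsub>?B\<^esub> w i"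
    using basis by (auto simp: is_canonical_basis_def is_basis_def)
  \<comment> \<open>Membership in \<open>nichols_plus\<close> provides lifts with zero constant
    term, as the locale requires.\<close>
  have "w i \<in> nichols_plus V" if "i < n" for i
    using span W(1) that span_in_superset[of "w i" "w ` {..<n}" ?B] by auto
  then have "\<exists>p. keys p \<subseteq> words_of V \<and> lookup p [] = 0 \<and> nichols_class V p = w i" if "i < n" for i
    using that unfolding nichols_plus_def by fastforce
  then obtain x where x: "\<And>i. i < n \<Longrightarrow> keys (x i) \<subseteq> words_of V"
      "\<And>i. i < n \<Longrightarrow> lookup (x i) [] = 0" "\<And>i. i < n \<Longrightarrow> nichols_class V (x i) = w i"
    by metis
  interpret nichols_eigenvectors V Y x
  proof
    fix i g assume "i < yd_dim Y"
    then have "i < n" using basis(2) by simp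
    then show "nichols_class V (g_act V g (x i)) = nichols_class V (scale (yd_chr Y i g) (x i))"
      using w_chr[of i g] by (simp add: nichols_class_g_act[OF V] nichols_smult[OF V] flip: x(3))
  qed (use V Y x basis(2) in auto)
  have "(\<lambda>i. nichols_class V (x i)) ` {..<yd_dim Y} = w ` {..<n}"
    using x(3) basis(2) by auto
  then have A_eq: "A = evA" using evA_generated span A by simp
  have A_carrier: "A \<subseteq> carrier ?B"
    using evA_subalgebra by (simp add: A_eq is_subalgebra_def is_subspace_def)
  have \<iota>: "\<iota> (w i) \<in> carrier (nichols_algebra (dual_yd V))" if "i < n" for i
    using iota nichols_class_closed[OF V x(1)[OF that]] x(3)[OF that]
    unfolding is_dual_iso_def by (auto dest!: bij_betwE)
  define d where "d i = act (boson_of V (\<iota> (w i)))" for i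
  have F: "boson_of V (\<iota> (w i)) \<in> carrier (dual_boson V)" if "i < n" for i
    by (rule boson_of_closed[OF V \<iota>[OF that]])
  have "d i (ev p) = ev (scale (lam i) (g_act Y (- yd_deg Y i) (rder Y i p)))"
    if i: "i < yd_dim Y" and p: "keys p \<subseteq> words_of Y" for i p
  proof (rule skew_derivation_ev[OF _ _ _ _ _ p])
    have i': "i < n" using i basis(2) by simp
    note act = action[unfolded is_nichols_action_def Let_def]
    fix a assume a: "a \<in> evA"
    then have a': "a \<in> carrier ?B" using A_carrier A_eq by blast
    show "d i a \<in> carrier ?B" using act F[OF i'] a' by (simp add: d_def)
    show "d i (c \<odot>\<^bsub>?B\<^esub> a) = c \<odot>\<^bsub>?B\<^esub> d i a" for c using act F[OF i'] a' by (simp add: d_def)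
    fix b assume b: "b \<in> evA"
    then have b': "b \<in> carrier ?B" using A_carrier A_eq by blast
    show "d i (a \<oplus>\<^bsub>?B\<^esub> b) = d i a \<oplus>\<^bsub>?B\<^esub> d i b" using act F[OF i'] a' b' by (simp add: d_def)
    show "d i (a \<otimes>\<^bsub>?B\<^esub> b) = d i a \<otimes>\<^bsub>?B\<^esub> b \<oplus>\<^bsub>?B\<^esub> nichols_g_act V (- yd_deg Y i) a \<otimes>\<^bsub>?B\<^esub> d i b"
      unfolding d_def
      by (rule skew_derivation[OF V coproduct action \<iota>[OF i'] A_carrier skew[OF i']]) (use a b A_eq in auto)
  next
    fix j assume "j < yd_dim Y"
    then show "d i (nichols_class V (x j)) = (if i = j then lam i else 0) \<odot>\<^bsub>?B\<^esub> \<one>\<^bsub>?B\<^esub>"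
      using pairing[of i j] x(3)[of j] i basis(2) by (simp add: d_def)
  qed
  then have kernel: "p \<in> nulls Y" if "keys p \<subseteq> words_of Y" "word_subst x p \<in> nulls V" for p
    using kernel_subset_nulls[of d lam p] that lam basis(2) by blast
  obtain \<phi> where "\<phi> \<in> alg_hom (?B\<lparr>carrier := A\<rparr>) (nichols_algebra Y)"
      "\<phi> ` A = carrier (nichols_algebra Y)" "\<forall>i<n. \<phi> (nichols_class V (x i)) = nichols_gen Y i"
    using quotient_map[OF kernel] unfolding A_eq basis(2) by blast
  moreover from this have "\<forall>i<n. \<phi> (w i) = nichols_gen Y i" using x(3) by simp
  moreover have "finite_dim ?B \<Longrightarrow> finite_dim (nichols_algebra Y)"
    by (rule finite_dim_transfer[OF kernel])
  ultimately show ?thesis by blast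
qed

end
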